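(* Almost surely, $\dfrac{\log \tau_\epsilon}{-\log \epsilon}$ converges to $2d$ as $\epsilon\to 0$.
   Context: Let $d\ge 1$ be an integer. Let $(Y_n)_{n\ge 0}$ be a sequence of independent random variables, each uniformly distributed on $(0,1)^d$. Let $(S_n)_{n\ge 0}$ be the simple symmetric random walk on $\mathbb{Z}$: $S_0=0$ and $S_n=\sum_{k=1}^n X_k$, where $(X_k)_{k\ge1}$ are independent with $\mathbb{P}(X_k=1)=\mathbb{P}(X_k=-1)=1/2$. The sequences $(S_n)_{n\ge0}$ and $(Y_n)_{n\ge0}$ are independent of each other. Define the process $M_n:=(S_n,0)+Y_n\in\mathbb{R}\times(0,1)^{d-1}\subset\mathbb{R}^d$, where $(S_n,0)$ denotes the vector of $\mathbb{R}^d$ with first coordinate $S_n$ and all other coordinates $0$. Fix a norm on $\mathbb{R}^d$ and let $B(x,\epsilon)$ denote the open ball of center $x$ and radius $\epsilon$ for this norm. The first return time is $\tau_\epsilon:=\inf\{m\ge 1: M_m\in B(M_0,\epsilon)\}$. *)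

theory Defs
  imports "HOL-Probability.Probability"
begin

definition is_norm :: "('v::real_vector \<Rightarrow> real) \<Rightarrow> bool" where
  "is_norm N \<longleftrightarrow>
     (\<forall>x. N x = 0 \<longleftrightarrow> x = 0) \<and>
     (\<forall>a x. N (a *\<^sub>R x) = \<bar>a\<bar> * N x) \<and>
     (\<forall>x y. N (x + y) \<le> N x + N y)"

definition norm_ball :: "('v::real_vector \<Rightarrow> real) \<Rightarrow> 'v \<Rightarrow> real \<Rightarrow> 'v set" where
  "norm_ball N x \<epsilon> = {y. N (y - x) < \<epsilon>}"

definition walk :: "(nat \<Rightarrow> 'w \<Rightarrow> int) \<Rightarrow> nat \<Rightarrow> 'w \<Rightarrow> int" where
  "walk X n \<omega> = (\<Sum>k = 1..n. X k \<omega>)"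

(* The index i plays the role of the first coordinate, so that axis i s is the vector (s, 0). *)
definition walk_process ::
  "'d \<Rightarrow> (nat \<Rightarrow> 'w \<Rightarrow> int) \<Rightarrow> (nat \<Rightarrow> 'w \<Rightarrow> real ^ 'd::finite) \<Rightarrow> nat \<Rightarrow> 'w \<Rightarrow> real ^ 'd" where
  "walk_process i X Y n \<omega> = axis i (real_of_int (walk X n \<omega>)) + Y n \<omega>"

(* In enat the infimum of the empty set is infinity: no return means infinite return time. *)
definition return_time ::
  "('v::real_vector \<Rightarrow> real) \<Rightarrow> (nat \<Rightarrow> 'v) \<Rightarrow> real \<Rightarrow> enat" where
  "return_time N m \<epsilon> = Inf {enat n | n. n \<ge> 1 \<and> m n \<in> norm_ball N (m 0) \<epsilon>}"

(* Intended for arguments at least 1; at 0 it inherits the library value of ln 0. *)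
definition ln_enat :: "enat \<Rightarrow> ereal" where
  "ln_enat t = (case t of enat n \<Rightarrow> ereal (ln (real n)) | \<infinity> \<Rightarrow> \<infinity>)"

definition unit_cube :: "(real ^ 'd::finite) set" where
  "unit_cube = {x. \<forall>j. 0 < x $ j \<and> x $ j < 1}"

(* The sigma-algebra on the sample space generated by a whole sequence of random variables.
   The library's indep_var needs both variables to have the same value type, so independence
   of an integer sequence and a vector sequence is stated through these sigma-algebras. *)
definition generated_sets ::
  "'w measure \<Rightarrow> 'b measure \<Rightarrow> (nat \<Rightarrow> 'w \<Rightarrow> 'b) \<Rightarrow> 'w set set" where
  "generated_sets P B Z =
     sets (vimage_algebra (space P) (\<lambda>\<omega> n. Z n \<omega>) (PiM UNIV (\<lambda>_. B)))"

end

theory Submission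
  imports Defs
begin

text \<open>
  A return at scale \<open>\<epsilon>\<close> needs two coincidences: the walk must be back at (or next to)
  its origin, and the uniform shift must hit a ball of volume of order \<open>\<epsilon> ^ d\<close>. Up to time
  \<open>n\<close> the walk spends about \<open>sqrt n\<close> steps at the origin, and each of them is an independent
  trial with success probability of order \<open>\<epsilon> ^ d\<close>. Hence the first success is expected when
  \<open>sqrt n\<close> is of order \<open>\<epsilon> ^ -d\<close>, that is at \<open>n = \<epsilon> ^ -(2 * d)\<close>.

  Both halves of this heuristic are made quantitative at one scale, with the unit cube cut into
  cells of side \<open>1 / K\<close>. Working with cells makes every event a finite union of events that
  factor over independent variables, so no conditioning on the starting point is needed.

  \<^item> The return cannot be much earlier (\<open>prob_near_return\<close>). By \<open>position_prob_le\<close> the walk is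
    at a given site at time \<open>m\<close> with probability at most \<open>1 / sqrt (m + 1)\<close>, so a union
    bound over the times up to \<open>n\<close> and over the \<open>3 ^ d\<close> neighbouring cells gives a bound of order
    \<open>sqrt n / K ^ d\<close>.

  \<^item> The return cannot be much later (\<open>prob_no_cell_return\<close>). If the walk has visited the origin
    at least \<open>r\<close> times, missing the starting cell each time has probability at most
    \<open>(1 - K ^ -d) ^ r\<close>. What remains is the lower tail of the number of visits
    (\<open>few_visits_prob_le\<close>): fewer than \<open>r\<close> visits up to time \<open>n\<close> have probability of order
    at most \<open>r / sqrt n\<close>. This comes from a comparison with the time at which a simple
    walk started at \<open>r\<close> hits zero.

  For a fixed \<open>j\<close>, both bounds are of order \<open>2 ^ -k\<close> along the scales \<open>K = 2 ^ (j * k)\<close> with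
  times \<open>4 ^ (k * (d * j - 1))\<close> and \<open>4 ^ (k * (d * j + 2))\<close>. By Borel--Cantelli the return time
  is almost surely squeezed between these times from some \<open>k\<close> on. Since the return time is
  monotone in \<open>\<epsilon>\<close>, interpolating between the scales costs a bounded additive error in the
  logarithm, and the exponents \<open>2 * d - 2 / j\<close> and \<open>2 * d + 4 / j\<close> both tend to \<open>2 * d\<close>.
\<close>

section \<open>The position of the simple random walk\<close>

definition sign_lists :: "nat \<Rightarrow> int list set" where
  "sign_lists n = {l. set l \<subseteq> {1, -1} \<and> length l = n}"

text \<open>
  The uniform law on the first \<open>n\<close> steps of the walk, as a finite average: it allows
  first-step arguments as plain recursions on lists.
\<close>

definition sign_mean :: "nat \<Rightarrow> (int list \<Rightarrow> real) \<Rightarrow> real" where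
  "sign_mean n F = (\<Sum>l\<in>sign_lists n. F l) / 2 ^ n"

lemma finite_sign_lists: "finite (sign_lists n)"
  unfolding sign_lists_def by (rule finite_lists_length_eq) simp

lemma card_sign_lists: "card (sign_lists n) = 2 ^ n"
  unfolding sign_lists_def by (subst card_lists_length_eq) (auto simp: numeral_2_eq_2)

lemma sign_lists_0: "sign_lists 0 = {[]}"
  by (auto simp: sign_lists_def)

lemma sign_lists_Suc:
  "sign_lists (Suc n) = (#) 1 ` sign_lists n \<union> (#) (-1) ` sign_lists n"
  by (auto simp: sign_lists_def image_iff length_Suc_conv)

lemma sign_mean_0: "sign_mean 0 F = F []"
  by (simp add: sign_mean_def sign_lists_0)

lemma sign_mean_Suc:
  "sign_mean (Suc n) F = (sign_mean n (\<lambda>l. F (1 # l)) + sign_mean n (\<lambda>l. F (-1 # l))) / 2"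
proof -
  have "(\<Sum>l\<in>sign_lists (Suc n). F l)
      = (\<Sum>l\<in>(#) 1 ` sign_lists n. F l) + (\<Sum>l\<in>(#) (-1) ` sign_lists n. F l)"
    unfolding sign_lists_Suc by (rule sum.union_disjoint) (auto simp: finite_sign_lists)
  also have "\<dots> = (\<Sum>l\<in>sign_lists n. F (1 # l)) + (\<Sum>l\<in>sign_lists n. F (-1 # l))"
    by (simp add: sum.reindex)
  finally show ?thesis
    by (simp add: sign_mean_def add_divide_distrib)
qed

lemma sign_mean_mono:
  assumes "\<And>l. l \<in> sign_lists n \<Longrightarrow> F l \<le> G l"
  shows "sign_mean n F \<le> sign_mean n G"
  unfolding sign_mean_def by (intro divide_right_mono sum_mono assms) auto

lemma sign_mean_const: "sign_mean n (\<lambda>l. c) = c"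
  by (simp add: sign_mean_def card_sign_lists)

lemma sign_mean_add: "sign_mean n (\<lambda>l. F l + G l) = sign_mean n F + sign_mean n G"
  by (simp add: sign_mean_def sum.distrib add_divide_distrib)

definition position_prob :: "nat \<Rightarrow> int \<Rightarrow> real" where
  "position_prob m s = sign_mean m (\<lambda>l. of_bool (sum_list l = s))"

lemma position_prob_0: "position_prob 0 s = of_bool (s = 0)"
  by (auto simp: position_prob_def sign_mean_0)

lemma position_prob_Suc:
  "position_prob (Suc m) s = (position_prob m (s - 1) + position_prob m (s + 1)) / 2"
  by (simp add: position_prob_def sign_mean_Suc diff_eq_eq eq_diff_eq add.commute)

text \<open>
  After \<open>m\<close> steps, of which \<open>j\<close> go up, the walk is at \<open>2 * j - m\<close>.
\<close>

lemma position_prob_support: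
  "position_prob m s \<noteq> 0 \<Longrightarrow> \<exists>j. s = 2 * int j - int m"
proof (induction m arbitrary: s)
  case 0
  then show ?case by (auto simp: position_prob_0 intro: exI[of _ 0])
next
  case (Suc m)
  then consider "position_prob m (s - 1) \<noteq> 0" | "position_prob m (s + 1) \<noteq> 0"
    unfolding position_prob_Suc by fastforce
  then show ?case
  proof cases
    case 1
    then obtain j where "s - 1 = 2 * int j - int m" using Suc.IH by blast
    then show ?thesis by (intro exI[of _ "Suc j"]) simp
  next
    case 2
    then obtain j where "s + 1 = 2 * int j - int m" using Suc.IH by blast
    then show ?thesis by (intro exI[of _ j]) simp
  qed
qed

lemma position_prob_eq_binomial:
  "position_prob m (2 * int j - int m) = (m choose j) / 2 ^ m"
proof (induction m arbitrary: j)
  case 0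
  then show ?case by (cases j) (auto simp: position_prob_0)
next
  case (Suc m)
  have right: "position_prob m (2 * int j - int (Suc m) + 1) = (m choose j) / 2 ^ m"
    using Suc.IH[of j] by (simp add: algebra_simps)
  show ?case
  proof (cases j)
    case 0
    have "position_prob m (- int m - 2) = 0"
      using position_prob_support[of m "- int m - 2"] by force
    with right show ?thesis
      by (simp add: position_prob_Suc 0 algebra_simps)
  next
    case (Suc j')
    have "position_prob m (2 * int j - int (Suc m) - 1) = (m choose j') / 2 ^ m"
      using Suc.IH[of j'] Suc by (simp add: algebra_simps)
    with right show ?thesis
      by (simp add: position_prob_Suc Suc add_divide_distrib)
  qed
qed

text \<open>
  Written \<open>c n\<close>, the left-hand side has \<open>(c n)\<^sup>2 * (2 * n + 1)\<close> decreasing in \<open>n\<close>.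
\<close>

lemma central_binomial_le: "((2 * n) choose n) / 4 ^ n \<le> 1 / sqrt (2 * real n + 1)"
proof -
  define c where "c n = ((2 * n) choose n) / (4 ^ n :: real)" for n
  have step: "c (Suc n) = c n * ((2 * real n + 1) / (2 * real n + 2))" for n
  proof -
    have "Suc n * (2 * Suc n choose Suc n) = (2 * Suc n) * (Suc (2 * n) choose n)"
      using Suc_times_binomial[of n "Suc (2 * n)"] by simp
    moreover have "Suc n * (Suc (2 * n) choose n) = Suc (2 * n) * ((2 * n) choose n)"
      using binomial_absorb_comp[of "Suc (2 * n)" n] by simp
    ultimately have "Suc n * (2 * Suc n choose Suc n) = 2 * (Suc (2 * n) * ((2 * n) choose n))"
      by (simp only: mult.assoc)
    then have "real (Suc n * (2 * Suc n choose Suc n)) = real (2 * (Suc (2 * n) * ((2 * n) choose n)))"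
      by (rule arg_cong)
    then have "(real n + 1) * real (2 * Suc n choose Suc n) = 2 * ((2 * real n + 1) * real ((2 * n) choose n))"
      unfolding of_nat_mult by (simp add: add.commute del: binomial_Suc_Suc)
    moreover have "a / (4 * p) = (b / p) * ((2 * real n + 1) / (2 * real n + 2))"
      if "(real n + 1) * a = 2 * ((2 * real n + 1) * b)" "p > 0" for a b p :: real
    proof -
      have "a = 2 * ((2 * real n + 1) * b) / (real n + 1)"
        using that by (simp add: eq_divide_eq mult.commute)
      then show ?thesis using that(2) by (simp add: divide_simps) (simp add: algebra_simps)
    qed
    ultimately show ?thesis by (simp add: c_def del: binomial_Suc_Suc)
  qed
  have "c n ^ 2 * (2 * real n + 1) \<le> 1"
  proof (induction n)
    case 0
    then show ?case by (simp add: c_def)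
  next
    case (Suc n)
    have "((2 * real n + 1) / (2 * real n + 2)) ^ 2 * (2 * real (Suc n) + 1) \<le> 2 * real n + 1"
      by (simp add: power_divide pos_divide_le_eq) (simp add: power2_eq_square algebra_simps)
    then have "c n ^ 2 * (((2 * real n + 1) / (2 * real n + 2)) ^ 2 * (2 * real (Suc n) + 1))
        \<le> c n ^ 2 * (2 * real n + 1)"
      by (intro mult_left_mono) auto
    with Suc show ?case unfolding step by (simp only: power_mult_distrib mult.assoc)
  qed
  then have "(c n * sqrt (2 * real n + 1)) ^ 2 \<le> 1 ^ 2"
    by (simp add: power_mult_distrib)
  then have "c n * sqrt (2 * real n + 1) \<le> 1"
    by (rule power2_le_imp_le) simp
  then show ?thesis
    by (simp add: c_def field_simps)
qed

text \<open>
  Of all sites, the central one carries the largest binomial weight. For odd \<open>m\<close> that weight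
  equals the central weight of \<open>m + 1\<close>.
\<close>

lemma position_prob_le: "position_prob m s \<le> 1 / sqrt (m + 1)"
proof (cases "position_prob m s = 0")
  case False
  then obtain j where s: "s = 2 * int j - int m" using position_prob_support by blast
  have "position_prob m s = (m choose j) / 2 ^ m"
    unfolding s by (rule position_prob_eq_binomial)
  also have "\<dots> \<le> (m choose (m div 2)) / 2 ^ m"
    by (intro divide_right_mono) (auto intro: binomial_maximum)
  also have "\<dots> \<le> 1 / sqrt (m + 1)"
  proof (cases "even m")
    case True
    then obtain n where "m = 2 * n" by blast
    then show ?thesis using central_binomial_le[of n] by (simp add: power_mult add.commute)
  next
    case False
    then obtain n where n: "m = 2 * n + 1" by (rule oddE)
    have "(2 * Suc n choose Suc n) = 2 * (m choose n)"
      using binomial_symmetric[of n "Suc (2 * n)"] by (simp add: n)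
    then have "(m choose n) / 2 ^ m = (2 * Suc n choose Suc n) / 4 ^ Suc n"
      by (simp add: n power_mult del: binomial_Suc_Suc)
    also have "\<dots> \<le> 1 / sqrt (2 * real (Suc n) + 1)" by (rule central_binomial_le)
    also have "\<dots> \<le> 1 / sqrt (m + 1)"
      by (intro divide_left_mono) (auto simp: n)
    finally show ?thesis by (simp add: n)
  qed
  finally show ?thesis .
qed simp

text \<open>
  Compares the sum with the telescoping differences of \<open>2 * sqrt n\<close>.
\<close>

lemma sum_inverse_sqrt_le: "(\<Sum>m\<in>{1..n}. 1 / sqrt (real (m + 1))) \<le> 2 * sqrt n"
proof (induction n)
  case (Suc n)
  have "(sqrt (Suc n) - sqrt n) * (sqrt (Suc n) + sqrt n) = 1"
    by (simp add: algebra_simps)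
  moreover have "sqrt (Suc n) + sqrt n \<le> 2 * sqrt (Suc n)" by simp
  moreover have "0 \<le> sqrt (Suc n) - sqrt n" by simp
  ultimately have "1 \<le> (sqrt (Suc n) - sqrt n) * (2 * sqrt (Suc n))"
    by (metis mult_left_mono)
  then have "1 / sqrt (Suc n) \<le> 2 * sqrt (Suc n) - 2 * sqrt n"
    by (subst divide_le_eq) (simp add: algebra_simps)
  moreover have "1 / sqrt (real (Suc n + 1)) \<le> 1 / sqrt (Suc n)"
    by (intro divide_left_mono) auto
  ultimately show ?case using Suc by simp
qed simp

section \<open>The number of visits to the origin\<close>

text \<open>
  By the reflection principle this is the probability that a simple random walk started at
  \<open>z\<close> does not hit zero in its first \<open>m\<close> steps. Only the recursion and the boundary values of
  that probability are used, and they are read off directly from the formula.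
\<close>

definition survival_prob :: "nat \<Rightarrow> nat \<Rightarrow> real" where
  "survival_prob m z = (\<Sum>s\<in>{- int z<..int z}. position_prob m s)"

lemma survival_prob_zero: "survival_prob m 0 = 0"
  by (simp add: survival_prob_def)

lemma survival_prob_start: "survival_prob 0 (Suc z) = 1"
proof -
  have "survival_prob 0 (Suc z) = (\<Sum>s\<in>{- int (Suc z)<..int (Suc z)}. if s = 0 then 1 else 0)"
    unfolding survival_prob_def by (intro sum.cong) (auto simp: position_prob_0)
  then show ?thesis by (simp add: sum.delta)
qed

text \<open>
  The windows of width \<open>2 * z + 2\<close> shifted by one to either side regroup into the windows of the
  two neighbouring starting points.
\<close>

lemma survival_prob_step:
  "survival_prob (Suc m) (Suc z) = (survival_prob m (Suc (Suc z)) + survival_prob m z) / 2"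
proof -
  let ?p = "position_prob m"
  have shift: "(\<Sum>s\<in>{a<..b}. ?p (s + c)) = (\<Sum>s\<in>{a + c<..b + c}. ?p s)" for a b c :: int
    by (rule sum.reindex_bij_witness[of _ "\<lambda>s. s - c" "\<lambda>s. s + c"]) auto
  have split: "(\<Sum>s\<in>{a<..c}. ?p s) = (\<Sum>s\<in>{a<..b}. ?p s) + (\<Sum>s\<in>{b<..c}. ?p s)"
    if "a \<le> b" "b \<le> c" for a b c :: int
    using that by (subst sum.union_disjoint[symmetric]) (auto simp: ivl_disj_un)
  let ?z = "int z"
  have "2 * survival_prob (Suc m) (Suc z)
      = (\<Sum>s\<in>{-?z - 1<..?z + 1}. ?p (s + -1)) + (\<Sum>s\<in>{-?z - 1<..?z + 1}. ?p (s + 1))"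
    unfolding survival_prob_def position_prob_Suc sum_divide_distrib[symmetric] sum.distrib
    by (simp add: minus_diff_commute add.commute)
  also have "\<dots> = (\<Sum>s\<in>{-?z - 2<..?z}. ?p s) + (\<Sum>s\<in>{-?z<..?z + 2}. ?p s)"
    unfolding shift by (simp add: algebra_simps)
  also have "\<dots> = survival_prob m (Suc (Suc z)) + survival_prob m z"
    using split[of "-?z - 2" ?z "?z + 2"] split[of "-?z" ?z "?z + 2"]
    by (simp add: survival_prob_def algebra_simps)
  finally show ?thesis by simp
qed

lemma survival_prob_le: "survival_prob m z \<le> 2 * real z / sqrt (m + 1)"
proof -
  have "survival_prob m z \<le> real (card {- int z<..int z}) * (1 / sqrt (m + 1))"
    unfolding survival_prob_def by (intro sum_bounded_above position_prob_le)
  then show ?thesis by simp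
qed

text \<open>
  Visits to zero of the walk started at \<open>x\<close>; the starting time does not count.
\<close>

fun visits :: "int \<Rightarrow> int list \<Rightarrow> nat" where
  "visits x [] = 0"
| "visits x (e # l) = of_bool (x + e = 0) + visits (x + e) l"

definition few_visits_prob :: "nat \<Rightarrow> int \<Rightarrow> nat \<Rightarrow> real" where
  "few_visits_prob r x n = sign_mean n (\<lambda>l. of_bool (visits x l < r))"

lemma few_visits_prob_Suc:
  "few_visits_prob r x (Suc n)
     = (few_visits_prob (r - of_bool (x + 1 = 0)) (x + 1) n
        + few_visits_prob (r - of_bool (x - 1 = 0)) (x - 1) n) / 2"
  by (simp add: few_visits_prob_def sign_mean_Suc less_diff_conv add.commute)

lemma few_visits_prob_le_1: "few_visits_prob r x n \<le> 1"
proof -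
  have "few_visits_prob r x n \<le> sign_mean n (\<lambda>l. 1)"
    unfolding few_visits_prob_def by (rule sign_mean_mono) auto
  then show ?thesis by (simp add: sign_mean_const)
qed

lemma few_visits_prob_0: "few_visits_prob 0 x n = 0"
  by (simp add: few_visits_prob_def sign_mean_const)

text \<open>
  Follow \<open>\<bar>x\<bar>\<close> plus the number of visits that will still be missing at the next time at zero
  (which is now if \<open>x = 0\<close>). Away from zero, and also on arriving there, it moves like a simple random
  walk. On leaving zero it stays constant for one step: \<open>\<bar>x\<bar>\<close> becomes one, and the next visit
  reduces the missing number by one. Thus the last missing visit occurs when a simple random walk hits
  zero, delayed by one step for each departure from zero. The differences \<open>n - r\<close> and \<open>n - q\<close>
  discount these pauses.
\<close>

lemma few_visits_prob_le_survival:
  "few_visits_prob r 0 n \<le> survival_prob (n - r) r"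
  "x \<noteq> 0 \<Longrightarrow> few_visits_prob (Suc q) x n \<le> survival_prob (n - q) (nat \<bar>x\<bar> + q)"
proof (induction n arbitrary: r x q)
  case 0
  case 1
  show ?case
    by (cases r) (auto simp: few_visits_prob_0 survival_prob_zero survival_prob_start few_visits_prob_le_1)
  case 2
  then obtain y where "nat \<bar>x\<bar> + q = Suc y" by (cases "nat \<bar>x\<bar> + q") auto
  then show ?case using few_visits_prob_le_1 by (simp add: survival_prob_start)
next
  case (Suc n)
  case 1
  show ?case
  proof (cases r)
    case 0
    then show ?thesis by (simp add: few_visits_prob_0 survival_prob_zero)
  next
    case (Suc q)
    then show ?thesis
      using Suc.IH(2)[of 1 q] Suc.IH(2)[of "-1" q] by (simp add: few_visits_prob_Suc)
  qed
  case 2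
  show ?case
  proof (cases "n < q")
    case True
    from 2 obtain y where "nat \<bar>x\<bar> + q = Suc y" by (cases "nat \<bar>x\<bar> + q") auto
    with True show ?thesis using few_visits_prob_le_1 by (simp add: survival_prob_start)
  next
    case False
    obtain a where a: "nat \<bar>x\<bar> = Suc a" using 2 by (cases "nat \<bar>x\<bar>") auto
    have inward: "few_visits_prob (Suc q - of_bool (y = 0)) y n \<le> survival_prob (n - q) (a + q)"
      if "nat \<bar>y\<bar> = a" for y
      using that Suc.IH(1)[of q] Suc.IH(2)[of y q] by (cases "y = 0") auto
    have outward: "few_visits_prob (Suc q - of_bool (y = 0)) y n \<le> survival_prob (n - q) (Suc (Suc (a + q)))"
      if "nat \<bar>y\<bar> = Suc (Suc a)" for y
      using that Suc.IH(2)[of y q] by (cases "y = 0") auto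
    have "few_visits_prob (Suc q) x (Suc n)
        \<le> (survival_prob (n - q) (Suc (Suc (a + q))) + survival_prob (n - q) (a + q)) / 2"
    proof (cases "x > 0")
      case True
      then have "nat \<bar>x - 1\<bar> = a" "nat \<bar>x + 1\<bar> = Suc (Suc a)" using a by linarith+
      then show ?thesis unfolding few_visits_prob_Suc
        by (intro divide_right_mono add_mono inward outward) simp_all
    next
      case False
      then have "nat \<bar>x + 1\<bar> = a" "nat \<bar>x - 1\<bar> = Suc (Suc a)" using a 2 by linarith+
      then show ?thesis unfolding few_visits_prob_Suc
          add.commute[of "survival_prob (n - q) (Suc (Suc (a + q)))"]
        by (intro divide_right_mono add_mono inward outward) simp_all
    qed
    also have "\<dots> = survival_prob (Suc n - q) (nat \<bar>x\<bar> + q)"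
      using False a by (simp add: survival_prob_step Suc_diff_le)
    finally show ?thesis .
  qed
qed

lemma few_visits_prob_le: "few_visits_prob r 0 n \<le> 2 * real r / sqrt (real (n - r) + 1)"
  using few_visits_prob_le_survival(1)[of r n] survival_prob_le[of "n - r" r] by (simp add: add.commute)

text \<open>
  Turns the recursive count into the number of independent trials that the shifts get.
\<close>

lemma visits_eq_card:
  "visits x l = card {m \<in> {1..length l}. x + sum_list (take m l) = 0}"
proof (induction l arbitrary: x)
  case (Cons e l)
  let ?A = "{m \<in> {1..length l}. x + e + sum_list (take m l) = 0}"
  have eq: "{m \<in> {1..length (e # l)}. x + sum_list (take m (e # l)) = 0}
      = (if x + e = 0 then {1} else {}) \<union> Suc ` ?A" (is "?L = ?R")
  proof (intro set_eqI)
    fix m show "m \<in> ?L \<longleftrightarrow> m \<in> ?R"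
    proof (cases m)
      case (Suc m')
      then show ?thesis by (cases m') (auto simp: add.assoc)
    qed auto
  qed
  have "card (Suc ` ?A) = card ?A" by (simp add: card_image)
  then show ?case unfolding eq by (subst card_Un_disjoint) (auto simp: Cons)
qed simp

section \<open>Grid cells in the unit cube\<close>

definition grid_index :: "nat \<Rightarrow> real ^ 'd \<Rightarrow> 'd \<Rightarrow> int" where
  "grid_index K y = (\<lambda>j. \<lfloor>real K * y $ j\<rfloor>)"

definition grid :: "nat \<Rightarrow> ('d \<Rightarrow> int) set" where
  "grid K = (UNIV \<rightarrow>\<^sub>E {0..<int K})"

lemma finite_grid: "finite (grid K :: ('d::finite \<Rightarrow> int) set)"
  unfolding grid_def by (intro finite_PiE) auto

lemma card_grid: "card (grid K :: ('d::finite \<Rightarrow> int) set) = K ^ CARD('d)"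
  unfolding grid_def by (simp add: card_PiE)

lemma measurable_grid_index [measurable]:
  "grid_index K \<in> measurable borel (count_space (UNIV :: ('d::finite \<Rightarrow> int) set))"
proof -
  have [measurable]: "(\<lambda>y::real ^ 'd. y $ j) \<in> borel_measurable borel" for j
    by (intro borel_measurable_continuous_onI continuous_intros)
  have "grid_index K -` {z}
      = {y::real ^ 'd. \<forall>j. real_of_int (z j) \<le> real K * y $ j \<and> real K * y $ j < real_of_int (z j) + 1}" for z
    by (auto simp: grid_index_def fun_eq_iff floor_eq_iff)
  also have "\<dots> z \<in> sets borel" for z by measurable
  finally show ?thesis by (subst measurable_count_space_eq2_countable) auto
qed

lemma pred_grid_index_eq [measurable (raw)]:
  fixes z :: "'d::finite \<Rightarrow> int"
  assumes "f \<in> borel_measurable M"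
  shows "Measurable.pred M (\<lambda>x. grid_index K (f x) = z)"
proof -
  have "(\<lambda>x. grid_index K (f x)) \<in> measurable M (count_space (UNIV :: ('d \<Rightarrow> int) set))"
    using assms by (rule measurable_compose) (rule measurable_grid_index)
  from measurable_compose[OF this measurable_count_space[of "\<lambda>w. w = z"]] show ?thesis .
qed

lemma pred_bex_grid:
  fixes Q :: "('d::finite \<Rightarrow> int) \<Rightarrow> 'a \<Rightarrow> bool"
  assumes "\<And>z. Measurable.pred M (Q z)"
  shows "Measurable.pred M (\<lambda>x. \<exists>z\<in>grid K. Q z x)"
  using assms by (intro pred_intros_finite finite_grid)

lemma grid_index_in_grid:
  assumes "y \<in> unit_cube" "K > 0"
  shows "grid_index K y \<in> grid K"
proof -
  have "0 \<le> real K * y $ j" "real K * y $ j < real K" for j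
    using assms by (auto simp: unit_cube_def intro: mult_nonneg_nonneg less_imp_le)
  then show ?thesis by (auto simp: grid_def grid_index_def floor_less_iff)
qed

lemma unit_cube_eq_box: "unit_cube = box 0 (\<chi> j. (1 :: real))"
  by (auto simp: unit_cube_def mem_box_cart)

lemma prod_Basis_const: "(\<Prod>b\<in>Basis. ((\<chi> j. c) :: real ^ 'd::finite) \<bullet> b) = c ^ CARD('d)"
proof -
  have "(\<Prod>b\<in>Basis. ((\<chi> j. c) :: real ^ 'd) \<bullet> b) = (\<Prod>b\<in>(Basis :: (real ^ 'd) set). c)"
    by (intro prod.cong) (auto simp: Basis_vec_def inner_axis)
  then show ?thesis by simp
qed

lemma measure_cbox_side:
  assumes "c \<ge> 0"
  shows "measure lborel (cbox a (a + (\<chi> j. c)) :: (real ^ 'd::finite) set) = c ^ CARD('d)"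
    and "measure lborel (box a (a + (\<chi> j. c)) :: (real ^ 'd::finite) set) = c ^ CARD('d)"
proof -
  have "\<forall>b\<in>Basis. a \<bullet> b \<le> (a + (\<chi> j. c) :: real ^ 'd) \<bullet> b"
    using assms by (auto simp: Basis_vec_def inner_axis inner_add_left)
  then show "measure lborel (cbox a (a + (\<chi> j. c)) :: (real ^ 'd::finite) set) = c ^ CARD('d)"
    and "measure lborel (box a (a + (\<chi> j. c)) :: (real ^ 'd::finite) set) = c ^ CARD('d)"
    by (simp_all add: measure_lborel_cbox_eq measure_lborel_box_eq prod_Basis_const)
qed

lemma emeasure_unit_cube: "emeasure lborel (unit_cube :: (real ^ 'd::finite) set) = 1"
proof -
  have "measure lborel (unit_cube :: (real ^ 'd) set) = 1"
    using measure_cbox_side(2)[of 1 0] by (simp add: unit_cube_eq_box)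
  moreover have "emeasure lborel (unit_cube :: (real ^ 'd) set) < \<infinity>"
    unfolding unit_cube_eq_box by (intro emeasure_bounded_finite bounded_box)
  ultimately show ?thesis by (simp add: emeasure_eq_ennreal_measure top.not_eq_extremum)
qed

definition cell_prob :: "nat \<Rightarrow> ('d::finite \<Rightarrow> int) \<Rightarrow> real" where
  "cell_prob K z = measure (uniform_measure lborel unit_cube) {y :: real ^ 'd. grid_index K y = z}"

text \<open>
  A cell lies between the open and the closed box of side \<open>1 / K\<close>, which have the same volume;
  cells with an index in the grid lie, up to their boundary, inside the cube.
\<close>

lemma cell_prob_bounds:
  fixes z :: "'d::finite \<Rightarrow> int"
  assumes K: "K > 0"
  shows "cell_prob K z \<le> (1 / K) ^ CARD('d)"
    and "z \<in> grid K \<Longrightarrow> cell_prob K z = (1 / K) ^ CARD('d)"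
proof -
  let ?C = "{y :: real ^ 'd. grid_index K y = z}"
  define a :: "real ^ 'd" where "a = (\<chi> j. z j / K)"
  define w :: "real ^ 'd" where "w = (\<chi> j. 1 / K)"
  have C: "?C = {y. \<forall>j. z j \<le> real K * y $ j \<and> real K * y $ j < z j + 1}"
    by (auto simp: grid_index_def fun_eq_iff floor_eq_iff)
  have meas: "unit_cube \<inter> ?C \<in> sets lborel"
    unfolding unit_cube_eq_box by measurable
  have eq: "cell_prob K z = measure lborel (unit_cube \<inter> ?C)"
    unfolding cell_prob_def
    by (subst measure_uniform_measure) (simp_all add: emeasure_unit_cube measure_def)
  have upper: "unit_cube \<inter> ?C \<subseteq> cbox a (a + w)"
    using K by (auto simp: C mem_box_cart a_def w_def field_simps less_imp_le)
  have "measure lborel (unit_cube \<inter> ?C) \<le> measure lborel (cbox a (a + w))"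
    by (rule measure_mono_fmeasurable[OF upper meas]) simp
  then show le: "cell_prob K z \<le> (1 / K) ^ CARD('d)"
    unfolding eq w_def by (subst (asm) measure_cbox_side) auto
  assume z: "z \<in> grid K"
  have lower: "box a (a + w) \<subseteq> unit_cube \<inter> ?C"
  proof
    fix y assume y: "y \<in> box a (a + w)"
    have "z j \<ge> 0 \<and> z j + 1 \<le> int K" for j
      using PiE_mem[OF z[unfolded grid_def], of j] by simp
    then have zj: "real_of_int (z j) \<ge> 0" "real_of_int (z j) + 1 \<le> real K" for j
      by (metis of_int_0_le_iff, metis of_int_1 of_int_add of_int_le_iff of_int_of_nat_eq)
    have yj: "z j < real K * y $ j" "real K * y $ j < z j + 1" for j
      using y K by (auto simp: mem_box_cart a_def w_def field_simps)
    have "0 < real K * y $ j" "real K * y $ j < real K * 1" for j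
      using zj[of j] yj[of j] by linarith+
    then have "0 < y $ j" "y $ j < 1" for j
      using K by (simp_all add: zero_less_mult_iff)
    with yj show "y \<in> unit_cube \<inter> ?C" by (auto simp: C unit_cube_def less_imp_le)
  qed
  have "unit_cube \<inter> ?C \<in> fmeasurable lborel"
    by (rule fmeasurableI2[OF fmeasurable_cbox upper meas])
  from measure_mono_fmeasurable[OF lower _ this]
  have "measure lborel (box a (a + w)) \<le> measure lborel (unit_cube \<inter> ?C)" by simp
  then have "cell_prob K z \<ge> (1 / K) ^ CARD('d)"
    unfolding eq w_def by (subst (asm) measure_cbox_side) auto
  with le show "cell_prob K z = (1 / K) ^ CARD('d)" by simp
qed

section \<open>The walk and the shifts on a common probability space\<close>

text \<open>
  Brings an event into the form in which the independence of the two sequences is stated.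
\<close>

lemma generated_setsI:
  assumes "Measurable.pred (PiM UNIV (\<lambda>_. B)) Q" and "space B = UNIV"
  shows "{\<omega> \<in> space P. Q (\<lambda>n. Z n \<omega>)} \<in> generated_sets P B Z"
proof -
  have "space (PiM (UNIV :: nat set) (\<lambda>_. B)) = UNIV"
    using assms(2) by (simp add: space_PiM PiE_def extensional_def)
  then have "{f. Q f} \<in> sets (PiM UNIV (\<lambda>_. B))"
    using assms(1) by (simp add: pred_def)
  from in_vimage_algebra[OF this, of "\<lambda>\<omega> n. Z n \<omega>" "space P"] show ?thesis
    unfolding generated_sets_def by (simp add: vimage_def Int_def conj_commute)
qed

locale uniform_shifted_walk = prob_space P
  for P :: "'w measure" +
  fixes X :: "nat \<Rightarrow> 'w \<Rightarrow> int" and Y :: "nat \<Rightarrow> 'w \<Rightarrow> real ^ 'd::finite"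
  assumes indep_Y: "indep_vars (\<lambda>_. borel) Y UNIV"
    and law_Y: "\<And>n. distr P borel (Y n) = uniform_measure lborel unit_cube"
    and indep_X: "indep_vars (\<lambda>_. count_space UNIV) X {1..}"
    and X_up: "\<And>k. k \<ge> 1 \<Longrightarrow> prob {\<omega> \<in> space P. X k \<omega> = 1} = 1 / 2"
    and X_down: "\<And>k. k \<ge> 1 \<Longrightarrow> prob {\<omega> \<in> space P. X k \<omega> = -1} = 1 / 2"
    and indep_walk_Y:
      "indep_set (generated_sets P (count_space UNIV) (walk X)) (generated_sets P borel Y)"
begin

lemma measurable_X: "k \<ge> 1 \<Longrightarrow> X k \<in> measurable P (count_space UNIV)"
  using indep_X by (auto simp: indep_vars_def)

lemma measurable_walk [measurable]: "walk X m \<in> measurable P (count_space UNIV)"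
proof -
  have "(\<lambda>\<omega>. \<Sum>k\<in>{1..m}. X k \<omega>) \<in> measurable P (count_space UNIV)"
  proof (induction m)
    case (Suc m)
    have [measurable]: "X (Suc m) \<in> measurable P (count_space UNIV)" by (rule measurable_X) simp
    show ?case using Suc by simp
  qed simp
  then show ?thesis by (simp add: walk_def[abs_def])
qed

lemma measurable_Y [measurable]: "Y n \<in> borel_measurable P"
  using indep_Y by (auto simp: indep_vars_def)

lemma AE_step: "k \<ge> 1 \<Longrightarrow> AE \<omega> in P. X k \<omega> \<in> {1, -1}"
proof -
  assume k: "k \<ge> 1"
  note [measurable] = measurable_X[OF k]
  have "prob ({\<omega> \<in> space P. X k \<omega> = 1} \<union> {\<omega> \<in> space P. X k \<omega> = -1}) = 1"
    using X_up[OF k] X_down[OF k] by (subst finite_measure_Union) auto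
  from AE_prob_1[OF this] show ?thesis by eventually_elim auto
qed

lemma AE_unit_cube: "AE \<omega> in P. Y n \<omega> \<in> unit_cube"
proof -
  have cube: "unit_cube \<in> sets (borel :: (real ^ 'd) measure)" by (simp add: unit_cube_eq_box)
  have "AE y in distr P borel (Y n). y \<in> unit_cube"
    unfolding law_Y by (rule AE_uniform_measureI) (use cube in auto)
  then show ?thesis by (subst (asm) AE_distr_iff) (use cube in auto)
qed

lemma prob_index: "prob {\<omega> \<in> space P. grid_index K (Y n \<omega>) = z} = cell_prob K z"
proof -
  have "cell_prob K z = measure (distr P borel (Y n)) {y. grid_index K y = z}"
    by (simp add: cell_prob_def law_Y)
  also have "\<dots> = prob (Y n -` {y. grid_index K y = z} \<inter> space P)"
    by (rule measure_distr) auto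
  also have "Y n -` {y. grid_index K y = z} \<inter> space P = {\<omega> \<in> space P. grid_index K (Y n \<omega>) = z}"
    by auto
  finally show ?thesis by simp
qed

text \<open>
  The event that the walk has \<open>l\<close> as its list of first steps, phrased through the positions
  because independence from the shifts is assumed for the sequence of positions.
\<close>

definition follows :: "int list \<Rightarrow> 'w set" where
  "follows l = {\<omega> \<in> space P. \<forall>m\<in>{..length l}. walk X m \<omega> = sum_list (take m l)}"

lemma follows_generated: "follows l \<in> generated_sets P (count_space UNIV) (walk X)"
  unfolding follows_def by (intro generated_setsI) simp_all

lemma sets_follows [measurable]: "follows l \<in> sets P"
  unfolding follows_def by measurable

lemma walk_Suc: "walk X (Suc m) \<omega> = walk X m \<omega> + X (Suc m) \<omega>"
  by (simp add: walk_def)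

lemma walk_0: "walk X 0 \<omega> = 0"
  by (simp add: walk_def)

lemma follows_iff:
  "\<omega> \<in> follows l \<longleftrightarrow> \<omega> \<in> space P \<and> (\<forall>k\<in>{1..length l}. X k \<omega> = l ! (k - 1))"
proof -
  have "(\<forall>m\<in>{..n}. walk X m \<omega> = sum_list (take m l)) \<longleftrightarrow> (\<forall>k\<in>{1..n}. X k \<omega> = l ! (k - 1))"
    if "n \<le> length l" for n
    using that
  proof (induction n)
    case 0
    then show ?case by (simp add: walk_0)
  next
    case (Suc n)
    then have "(\<forall>m\<in>{..Suc n}. walk X m \<omega> = sum_list (take m l)) \<longleftrightarrow>
        (\<forall>k\<in>{1..n}. X k \<omega> = l ! (k - 1)) \<and> walk X (Suc n) \<omega> = sum_list (take (Suc n) l)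
        \<and> walk X n \<omega> = sum_list (take n l)"
      by (auto simp: atMost_Suc)
    \<comment> \<open>A step is the difference of two consecutive positions.\<close>
    also have "\<dots> \<longleftrightarrow> (\<forall>k\<in>{1..n}. X k \<omega> = l ! (k - 1)) \<and> X (Suc n) \<omega> = l ! n"
      using Suc by (auto simp: walk_Suc take_Suc_conv_app_nth)
    also have "\<dots> \<longleftrightarrow> (\<forall>k\<in>{1..Suc n}. X k \<omega> = l ! (k - 1))"
      by (auto simp: atLeastAtMostSuc_conv)
    finally show ?case .
  qed
  from this[of "length l"] show ?thesis by (auto simp: follows_def)
qed

lemma prob_follows:
  assumes l: "l \<in> sign_lists n"
  shows "prob (follows l) = 1 / 2 ^ n"
proof (cases "n = 0")
  case True
  then have "follows l = space P" using l by (auto simp: follows_iff sign_lists_def)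
  then show ?thesis using True by (simp add: prob_space)
next
  case False
  have len: "length l = n" using l by (simp add: sign_lists_def)
  have "follows l = (\<Inter>k\<in>{1..n}. X k -` {l ! (k - 1)} \<inter> space P)"
    using False by (auto simp: follows_iff len)
  also have "prob \<dots> = (\<Prod>k\<in>{1..n}. prob (X k -` {l ! (k - 1)} \<inter> space P))"
    using False by (intro indep_varsD[OF indep_X]) auto
  also have "\<dots> = (\<Prod>k\<in>{1..n}. 1 / 2)"
  proof (rule prod.cong)
    fix k assume k: "k \<in> {1..n}"
    then have "l ! (k - 1) \<in> set l" using len by (intro nth_mem) auto
    then have "l ! (k - 1) \<in> {1, -1}" using l by (auto simp: sign_lists_def)
    moreover have "X k -` {a} \<inter> space P = {\<omega> \<in> space P. X k \<omega> = a}" for a by auto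
    ultimately show "prob (X k -` {l ! (k - 1)} \<inter> space P) = 1 / 2"
      using k X_up[of k] X_down[of k] by auto
  qed simp
  finally show ?thesis by (simp add: power_divide)
qed

lemma AE_follows: "AE \<omega> in P. \<exists>l\<in>sign_lists n. \<omega> \<in> follows l"
proof -
  have "AE \<omega> in P. \<forall>k\<in>{1..n}. X k \<omega> \<in> {1, -1}"
    by (intro AE_finite_allI AE_step) auto
  then show ?thesis using AE_space
  proof eventually_elim
    fix \<omega> assume \<omega>: "\<forall>k\<in>{1..n}. X k \<omega> \<in> {1, -1}" "\<omega> \<in> space P"
    define l where "l = map (\<lambda>k. X k \<omega>) [1..<Suc n]"
    have "l \<in> sign_lists n" using \<omega>(1) by (auto simp: l_def sign_lists_def)
    moreover have "\<omega> \<in> follows l" using \<omega>(2) by (auto simp: follows_iff l_def simp del: upt_Suc)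
    ultimately show "\<exists>l\<in>sign_lists n. \<omega> \<in> follows l" by blast
  qed
qed

lemma prob_walk_eq: "prob {\<omega> \<in> space P. walk X m \<omega> = s} \<le> position_prob m s"
proof -
  let ?L = "{l \<in> sign_lists m. sum_list l = s}"
  have fin: "finite ?L" using finite_sign_lists by simp
  have "prob {\<omega> \<in> space P. walk X m \<omega> = s} \<le> prob (\<Union>l\<in>?L. follows l)"
  proof (rule finite_measure_mono_AE)
    show "AE \<omega> in P. \<omega> \<in> {\<omega> \<in> space P. walk X m \<omega> = s} \<longrightarrow> \<omega> \<in> (\<Union>l\<in>?L. follows l)"
      using AE_follows[of m] by eventually_elim (force simp: follows_def sign_lists_def)
  qed (use fin in auto)
  also have "\<dots> \<le> (\<Sum>l\<in>?L. prob (follows l))"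
    by (rule finite_measure_subadditive_finite) (use fin in auto)
  also have "\<dots> = (\<Sum>l\<in>?L. 1 / 2 ^ m)" by (intro sum.cong) (auto simp: prob_follows)
  also have "\<dots> = (\<Sum>l\<in>sign_lists m. of_bool (sum_list l = s)) / 2 ^ m"
    by (simp add: sum.If_cases finite_sign_lists of_bool_def Int_def)
  finally show ?thesis by (simp add: position_prob_def sign_mean_def)
qed

section \<open>Returns at one scale\<close>

text \<open>
  The starting shift lies in the cell and all shifts at the times in \<open>J\<close> avoid it: the events
  concern different times, hence the product.
\<close>

lemma prob_avoid_cell:
  assumes "finite J" "0 \<notin> J"
  shows "prob {\<omega> \<in> space P. grid_index K (Y 0 \<omega>) = z \<and> (\<forall>m\<in>J. grid_index K (Y m \<omega>) \<noteq> z)}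
    = cell_prob K z * (1 - cell_prob K z) ^ card J"
proof -
  define A where "A m = {y. (grid_index K y = z) = (m = 0)}" for m :: nat
  have "{\<omega> \<in> space P. grid_index K (Y 0 \<omega>) = z \<and> (\<forall>m\<in>J. grid_index K (Y m \<omega>) \<noteq> z)}
      = (\<Inter>m\<in>insert 0 J. Y m -` A m \<inter> space P)"
    using assms(2) by (auto simp: A_def)
  also have "prob \<dots> = (\<Prod>m\<in>insert 0 J. prob (Y m -` A m \<inter> space P))"
    by (rule indep_varsD[OF indep_Y]) (auto simp: A_def assms(1))
  also have "\<dots> = prob (Y 0 -` A 0 \<inter> space P) * (\<Prod>m\<in>J. prob (Y m -` A m \<inter> space P))"
    using assms by simp
  also have "Y 0 -` A 0 \<inter> space P = {\<omega> \<in> space P. grid_index K (Y 0 \<omega>) = z}"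
    by (auto simp: A_def)
  also have "(\<Prod>m\<in>J. prob (Y m -` A m \<inter> space P)) = (\<Prod>m\<in>J. 1 - cell_prob K z)"
  proof (rule prod.cong)
    fix m assume "m \<in> J"
    then have "Y m -` A m \<inter> space P = space P - {\<omega> \<in> space P. grid_index K (Y m \<omega>) = z}"
      using assms(2) by (auto simp: A_def intro: gr0I)
    then show "prob (Y m -` A m \<inter> space P) = 1 - cell_prob K z"
      by (simp add: prob_compl prob_index)
  qed simp
  finally show ?thesis by (simp add: prob_index)
qed

lemma AE_index_in_grid: "K > 0 \<Longrightarrow> AE \<omega> in P. grid_index K (Y n \<omega>) \<in> grid K"
  using AE_unit_cube[of n] by eventually_elim (auto intro: grid_index_in_grid)

text \<open>
  The cell is required to belong to the grid so that the event is a finite Boolean combination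
  of measurable events; almost surely the starting cell is one of these.
\<close>

definition no_cell_return :: "nat \<Rightarrow> nat \<Rightarrow> 'w set" where
  "no_cell_return K n = {\<omega> \<in> space P. \<forall>m\<in>{1..n}.
     \<not> (walk X m \<omega> = 0 \<and> (\<exists>z\<in>grid K. grid_index K (Y 0 \<omega>) = z \<and> grid_index K (Y m \<omega>) = z))}"

lemma sets_no_cell_return [measurable]: "no_cell_return K n \<in> sets P"
  unfolding no_cell_return_def
  by (intro predE pred_intros_finite pred_intros_logic pred_bex_grid pred_grid_index_eq) measurable

text \<open>
  Split according to the step list of the walk and the starting cell. Each step list gives as
  many independent trials as it has visits to zero, and summing over the starting cells cancels the
  probability of one cell. The number \<open>r\<close> separates paths with few visits, which are rare, from
  paths with many, on which all trials fail only with small probability.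
\<close>

lemma prob_no_cell_return:
  assumes K: "K > 0"
  shows "prob (no_cell_return K n)
    \<le> 2 * real r / sqrt (real (n - r) + 1) + (1 - (1 / K) ^ CARD('d)) ^ r"
proof -
  define p where "p = (1 / real K) ^ CARD('d)"
  have p: "0 < p" "p \<le> 1" using K by (auto simp: p_def power_le_one)
  define J where "J l = {m \<in> {1..length l}. sum_list (take m l) = 0}" for l :: "int list"
  have fin_J: "finite (J l)" "0 \<notin> J l" for l by (auto simp: J_def)
  have card_J: "card (J l) = visits 0 l" for l by (simp add: J_def visits_eq_card)
  define E where "E l z = {\<omega> \<in> space P. grid_index K (Y 0 \<omega>) = z \<and> (\<forall>m\<in>J l. grid_index K (Y m \<omega>) \<noteq> z)}"
    for l z
  have sets_E [measurable]: "E l z \<in> sets P" for l z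
    unfolding E_def using fin_J by measurable
  have gen_E: "E l z \<in> generated_sets P borel Y" for l z
    unfolding E_def
    by (intro generated_setsI pred_intros_logic pred_intros_finite fin_J pred_grid_index_eq) simp_all
  let ?I = "sign_lists n \<times> (grid K :: ('d \<Rightarrow> int) set)"
  have fin_I: "finite ?I" using finite_sign_lists finite_grid by blast
  have "prob (no_cell_return K n) \<le> prob (\<Union>(l, z)\<in>?I. follows l \<inter> E l z)"
  proof (rule finite_measure_mono_AE)
    show "AE \<omega> in P. \<omega> \<in> no_cell_return K n \<longrightarrow> \<omega> \<in> (\<Union>(l, z)\<in>?I. follows l \<inter> E l z)"
      using AE_follows[of n] AE_index_in_grid[OF K, of 0]
    proof (eventually_elim, intro impI)
      fix \<omega>
      assume "\<exists>l\<in>sign_lists n. \<omega> \<in> follows l" and grid: "grid_index K (Y 0 \<omega>) \<in> grid K"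
        and ncr: "\<omega> \<in> no_cell_return K n"
      then obtain l where l: "l \<in> sign_lists n" "\<omega> \<in> follows l" by blast
      then have "walk X m \<omega> = 0" "m \<in> {1..n}" if "m \<in> J l" for m
        using that by (auto simp: follows_def J_def sign_lists_def)
      with ncr grid have "\<omega> \<in> E l (grid_index K (Y 0 \<omega>))"
        unfolding E_def no_cell_return_def by fastforce
      with l grid show "\<omega> \<in> (\<Union>(l, z)\<in>?I. follows l \<inter> E l z)" by force
    qed
  qed (use fin_I in auto)
  also have "\<dots> \<le> (\<Sum>(l, z)\<in>?I. prob (follows l \<inter> E l z))"
    using finite_measure_subadditive_finite[OF fin_I, of "\<lambda>(l, z). follows l \<inter> E l z"]
    by (simp add: case_prod_unfold image_subset_iff)
  also have "\<dots> = (\<Sum>(l, z)\<in>?I. 1 / 2 ^ n * (p * (1 - p) ^ visits 0 l))"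
  proof (rule sum.cong, safe)
    fix l :: "int list" and z :: "'d \<Rightarrow> int" assume lz: "l \<in> sign_lists n" "z \<in> grid K"
    have "prob (follows l \<inter> E l z) = prob (follows l) * prob (E l z)"
      by (rule indep_setD[OF indep_walk_Y follows_generated gen_E])
    also have "prob (E l z) = p * (1 - p) ^ visits 0 l"
      unfolding E_def prob_avoid_cell[OF fin_J] card_J cell_prob_bounds(2)[OF K lz(2)] p_def ..
    finally show "prob (follows l \<inter> E l z) = 1 / 2 ^ n * (p * (1 - p) ^ visits 0 l)"
      using prob_follows[OF lz(1)] by simp
  qed
  also have "\<dots> = (\<Sum>l\<in>sign_lists n. \<Sum>z\<in>(grid K :: ('d \<Rightarrow> int) set). 1 / 2 ^ n * (p * (1 - p) ^ visits 0 l))"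
    by (rule sum.cartesian_product[symmetric])
  also have "\<dots> = real (K ^ CARD('d)) * p * sign_mean n (\<lambda>l. (1 - p) ^ visits 0 l)"
    by (simp add: sign_mean_def card_grid sum_divide_distrib sum_distrib_left mult.assoc)
  also have "real (K ^ CARD('d)) * p = 1" using K by (simp add: p_def power_divide)
  also have "1 * sign_mean n (\<lambda>l. (1 - p) ^ visits 0 l)
      \<le> sign_mean n (\<lambda>l. of_bool (visits 0 l < r) + (1 - p) ^ r)"
  proof -
    have "(1 - p) ^ visits 0 l \<le> of_bool (visits 0 l < r) + (1 - p) ^ r" for l
    proof (cases "visits 0 l < r")
      case True
      have "(1 - p) ^ visits 0 l \<le> 1" using p by (intro power_le_one) auto
      with True p show ?thesis by (simp add: add_increasing2)
    next
      case False
      then show ?thesis using p by (simp add: power_decreasing)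
    qed
    then show ?thesis by (simp add: sign_mean_mono)
  qed
  also have "\<dots> = few_visits_prob r 0 n + (1 - p) ^ r"
    by (simp add: sign_mean_add sign_mean_const few_visits_prob_def)
  finally show ?thesis using few_visits_prob_le[of r n] by (simp add: p_def)
qed

text \<open>
  Summed over the \<open>K ^ d\<close> starting cells, the product of two cell probabilities leaves one
  factor \<open>(1 / K) ^ d\<close>, whatever the offset \<open>w\<close> is.
\<close>

lemma prob_index_offset:
  assumes K: "K > 0" and m: "m \<ge> 1"
  shows "prob {\<omega> \<in> space P. \<exists>z\<in>grid K. grid_index K (Y 0 \<omega>) = z \<and> grid_index K (Y m \<omega>) = (\<lambda>j. z j + w j)}
    \<le> (1 / K) ^ CARD('d)"
proof -
  define p where "p = (1 / real K) ^ CARD('d)"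
  let ?G = "grid K :: ('d \<Rightarrow> int) set"
  let ?F = "\<lambda>z. {\<omega> \<in> space P. grid_index K (Y 0 \<omega>) = z \<and> grid_index K (Y m \<omega>) = (\<lambda>j. z j + w j)}"
  have "{\<omega> \<in> space P. \<exists>z\<in>?G. grid_index K (Y 0 \<omega>) = z \<and> grid_index K (Y m \<omega>) = (\<lambda>j. z j + w j)}
      = (\<Union>z\<in>?G. ?F z)" by auto
  also have "prob \<dots> \<le> (\<Sum>z\<in>?G. prob (?F z))"
    by (rule finite_measure_subadditive_finite[OF finite_grid]) auto
  also have "\<dots> \<le> (\<Sum>z\<in>?G. p * p)"
  proof (rule sum_mono)
    fix z :: "'d \<Rightarrow> int"
    define A where "A n = {y. grid_index K y = (if n = 0 then z else (\<lambda>j. z j + w j))}" for n :: nat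
    have "?F z = (\<Inter>n\<in>{0, m}. Y n -` A n \<inter> space P)"
      using m by (auto simp: A_def)
    also have "prob \<dots> = (\<Prod>n\<in>{0, m}. prob (Y n -` A n \<inter> space P))"
      by (rule indep_varsD[OF indep_Y]) (auto simp: A_def)
    also have "\<dots> = prob {\<omega> \<in> space P. grid_index K (Y 0 \<omega>) = z}
        * prob {\<omega> \<in> space P. grid_index K (Y m \<omega>) = (\<lambda>j. z j + w j)}"
      using m by (auto simp: A_def vimage_def Int_def conj_commute)
    also have "\<dots> \<le> p * p"
      unfolding prob_index p_def
      by (intro mult_mono cell_prob_bounds K) (auto simp: cell_prob_def)
    finally show "prob (?F z) \<le> p * p" .
  qed
  also have "\<dots> = p"
    using K by (simp add: card_grid p_def power_divide)
  finally show ?thesis by (simp add: p_def)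
qed

text \<open>
  The walk is at \<open>s\<close> and the cell of the process itself has moved by \<open>u\<close>; adding the integer \<open>s\<close>
  to the coordinate \<open>i\<close> moves the cell index by \<open>K * s\<close>.
\<close>

definition cell_passage :: "'d \<Rightarrow> nat \<Rightarrow> nat \<Rightarrow> int \<Rightarrow> ('d \<Rightarrow> int) \<Rightarrow> 'w set" where
  "cell_passage i K m s u = {\<omega> \<in> space P. walk X m \<omega> = s}
     \<inter> {\<omega> \<in> space P. \<exists>z\<in>grid K. grid_index K (Y 0 \<omega>) = z
          \<and> grid_index K (Y m \<omega>) = (\<lambda>j. z j + (u j - of_bool (j = i) * int K * s))}"

lemma sets_cell_passage [measurable]: "cell_passage i K m s u \<in> sets P"
  unfolding cell_passage_def by (intro sets.Int predE pred_bex_grid) measurable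

lemma prob_cell_passage:
  assumes K: "K > 0" and m: "m \<ge> 1"
  shows "prob (cell_passage i K m s u) \<le> (1 / K) ^ CARD('d) * (1 / sqrt (real (m + 1)))"
proof -
  let ?W = "{\<omega> \<in> space P. walk X m \<omega> = s}"
  let ?F = "{\<omega> \<in> space P. \<exists>z\<in>grid K. grid_index K (Y 0 \<omega>) = z
          \<and> grid_index K (Y m \<omega>) = (\<lambda>j. z j + (u j - of_bool (j = i) * int K * s))}"
  have "prob (cell_passage i K m s u) = prob ?W * prob ?F"
    unfolding cell_passage_def
  proof (rule indep_setD[OF indep_walk_Y])
    show "?W \<in> generated_sets P (count_space UNIV) (walk X)"
      by (intro generated_setsI) simp_all
    show "?F \<in> generated_sets P borel Y"
      by (intro generated_setsI pred_bex_grid) simp_all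
  qed
  also have "\<dots> \<le> 1 / sqrt (real (m + 1)) * (1 / K) ^ CARD('d)"
    using order_trans[OF prob_walk_eq[of m s] position_prob_le[of m s]]
      prob_index_offset[OF K m, of "\<lambda>j. u j - of_bool (j = i) * int K * s"]
    by (intro mult_mono) simp_all
  finally show ?thesis by (simp add: mult.commute)
qed

text \<open>
  Two points at distance less than \<open>1 / K\<close> in each coordinate have cell indices that differ
  by at most one in each coordinate. As the shifts stay in the unit cube, the walk itself must
  then be within distance one of its origin.
\<close>

definition near_return :: "'d \<Rightarrow> nat \<Rightarrow> nat \<Rightarrow> 'w set" where
  "near_return i K n =
     (\<Union>(m, s, u)\<in>{1..n} \<times> {-1..1} \<times> (UNIV \<rightarrow>\<^sub>E {-1..1}). cell_passage i K m s u)"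

lemma finite_near_index:
  "finite ({1..n::nat} \<times> {-1..1::int} \<times> (UNIV \<rightarrow>\<^sub>E {-1..1} :: ('d \<Rightarrow> int) set))"
  by (intro finite_cartesian_product finite_PiE) auto

lemma sets_near_return [measurable]: "near_return i K n \<in> sets P"
  unfolding near_return_def by (intro sets.finite_UN finite_near_index) auto

lemma prob_near_return:
  assumes K: "K > 0"
  shows "prob (near_return i K n) \<le> 6 * 3 ^ CARD('d) * (1 / K) ^ CARD('d) * sqrt n"
proof -
  define p where "p = (1 / real K) ^ CARD('d)"
  let ?S = "{-1..1} :: int set"
  let ?U = "UNIV \<rightarrow>\<^sub>E {-1..1} :: ('d \<Rightarrow> int) set"
  have card_U: "card ?U = 3 ^ CARD('d)" by (simp add: card_PiE)
  have "prob (near_return i K n) \<le> (\<Sum>(m, s, u)\<in>{1..n} \<times> ?S \<times> ?U. prob (cell_passage i K m s u))"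
    using finite_measure_subadditive_finite[OF finite_near_index, of "\<lambda>(m, s, u). cell_passage i K m s u"]
    by (simp add: near_return_def case_prod_unfold image_subset_iff)
  also have "\<dots> \<le> (\<Sum>(m, s, u)\<in>{1..n} \<times> ?S \<times> ?U. p * (1 / sqrt (real (m + 1))))"
    using prob_cell_passage[OF K] by (intro sum_mono) (auto simp: p_def)
  also have "\<dots> = (\<Sum>m\<in>{1..n}. \<Sum>x\<in>?S \<times> ?U. p * (1 / sqrt (real (m + 1))))"
    unfolding sum.cartesian_product by (simp add: case_prod_unfold)
  also have "\<dots> = 3 * 3 ^ CARD('d) * p * (\<Sum>m\<in>{1..n}. 1 / sqrt (real (m + 1)))"
    by (simp add: card_U card_cartesian_product sum_distrib_left mult.assoc)
  also have "\<dots> \<le> 3 * 3 ^ CARD('d) * p * (2 * sqrt n)"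
    by (intro mult_left_mono sum_inverse_sqrt_le) (auto simp: p_def)
  finally show ?thesis by (simp add: p_def mult_ac)
qed

end

section \<open>From cells to balls of the norm\<close>

text \<open>
  Equivalence of the given norm with the maximum norm: the upper constant comes from the
  triangle inequality along the axes, the lower one from the minimum of the norm over the compact
  Euclidean unit sphere.
\<close>

lemma is_norm_bounds:
  fixes N :: "real ^ 'd::finite \<Rightarrow> real"
  assumes "is_norm N"
  obtains c C where "c > 0" "C > 0"
    "\<And>v t j. N v < c * t \<Longrightarrow> \<bar>v $ j\<bar> < t"
    "\<And>v t. t > 0 \<Longrightarrow> (\<And>j. \<bar>v $ j\<bar> \<le> t) \<Longrightarrow> N v < C * t"
proof -
  have zero: "N v = 0 \<longleftrightarrow> v = 0" and scale: "N (a *\<^sub>R v) = \<bar>a\<bar> * N v"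
    and tri: "N (v + w) \<le> N v + N w" for v w a
    using assms by (auto simp: is_norm_def)
  have minus: "N (- v) = N v" for v using scale[of "-1" v] by simp
  have nonneg: "0 \<le> N v" for v using tri[of v "- v"] zero[of 0] minus[of v] by simp
  have sum_le: "N (sum f I) \<le> (\<Sum>i\<in>I. N (f i))" if "finite I" for f :: "'d \<Rightarrow> real ^ 'd" and I
    using that
  proof (induction I)
    case (insert i I)
    then show ?case using tri[of "f i" "sum f I"] by simp
  qed (use zero[of 0] in simp)
  define B where "B = (\<Sum>j\<in>UNIV. N (axis j (1::real) :: real ^ 'd))"
  have B: "B \<ge> 0" unfolding B_def by (intro sum_nonneg nonneg)
  have upper: "N v \<le> B * t" if "\<And>j. \<bar>v $ j\<bar> \<le> t" for v t
  proof -
    have "N v = N (\<Sum>j\<in>UNIV. v $ j *\<^sub>R axis j 1)"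
      using basis_expansion[of v] by (simp add: scalar_mult_eq_scaleR)
    also have "\<dots> \<le> (\<Sum>j\<in>UNIV. \<bar>v $ j\<bar> * N (axis j 1))"
      using sum_le[of UNIV "\<lambda>j. v $ j *\<^sub>R axis j 1"] by (simp add: scale)
    also have "\<dots> \<le> (\<Sum>j\<in>UNIV. t * N (axis j 1))"
      by (intro sum_mono mult_right_mono that nonneg)
    finally show ?thesis by (simp add: B_def sum_distrib_left mult.commute)
  qed
  have lip: "B-lipschitz_on UNIV N"
  proof (rule lipschitz_onI)
    fix x y :: "real ^ 'd"
    have "N x - N y \<le> N (x - y)" "N y - N x \<le> N (x - y)"
      using tri[of "x - y" y] tri[of "y - x" x] minus[of "x - y"] by auto
    moreover have "N (x - y) \<le> B * norm (x - y)"
      by (rule upper) (rule component_le_norm_cart)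
    ultimately show "dist (N x) (N y) \<le> B * dist x y" by (simp add: dist_norm)
  qed (rule B)
  \<comment> \<open>The minimiser of the norm on the sphere gives the lower constant.\<close>
  obtain x0 where x0: "norm x0 = 1" "\<And>x. norm x = 1 \<Longrightarrow> N x0 \<le> N x"
  proof -
    have "compact (sphere (0 :: real ^ 'd) 1)" "sphere (0 :: real ^ 'd) 1 \<noteq> {}" by auto
    from continuous_attains_inf[OF this, of N] show ?thesis
      using that lipschitz_on_continuous_on[OF lip] continuous_on_subset
      by (metis dist_0_norm mem_sphere subset_UNIV)
  qed
  have "N x0 > 0" using x0(1) zero[of x0] nonneg[of x0] by (cases "x0 = 0") auto
  moreover have "\<bar>v $ j\<bar> < t" if "N v < N x0 * t" for v t j
  proof -
    have "N x0 * norm v \<le> N v"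
    proof (cases "v = 0")
      case False
      have "N x0 \<le> N ((1 / norm v) *\<^sub>R v)" using False by (intro x0) simp
      with False show ?thesis by (simp add: scale field_simps)
    qed (use nonneg in simp)
    with that have "N x0 * norm v < N x0 * t" by linarith
    with \<open>N x0 > 0\<close> have "norm v < t" by simp
    with component_le_norm_cart[of v j] show ?thesis by linarith
  qed
  moreover have "N v < (B + 1) * t" if "t > 0" "\<And>j. \<bar>v $ j\<bar> \<le> t" for v t
    using upper[OF that(2)] that(1) by (simp add: algebra_simps add_strict_increasing)
  ultimately show thesis using that[of "N x0" "B + 1"] B by simp
qed

lemma return_time_le:
  assumes "n \<ge> 1" "N (m n - m 0) < \<epsilon>"
  shows "return_time N m \<epsilon> \<le> enat n"
  unfolding return_time_def using assms by (intro Inf_lower) (auto simp: norm_ball_def)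

text \<open>
  A set of extended naturals with infimum at most \<open>n\<close> has a member at most \<open>n\<close>, so the infimum
  in the definition of the return time is attained.
\<close>

lemma return_time_leD:
  assumes "return_time N m \<epsilon> \<le> enat n"
  obtains k where "k \<in> {1..n}" "N (m k - m 0) < \<epsilon>"
proof -
  have "return_time N m \<epsilon> < enat (Suc n)"
    using assms by (rule le_less_trans) simp
  then obtain k where "k \<ge> 1" "m k \<in> norm_ball N (m 0) \<epsilon>" "enat k < enat (Suc n)"
    unfolding return_time_def Inf_less_iff by blast
  then show thesis using that[of k] by (simp add: norm_ball_def)
qed

lemma return_time_ge_1: "1 \<le> return_time N m \<epsilon>"
  unfolding return_time_def by (intro Inf_greatest) (auto simp: one_enat_def)

lemma floor_difference_le_1:
  fixes a b x :: real and s :: int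
  assumes "\<bar>x * (a - b) + s\<bar> < 1"
  shows "\<bar>\<lfloor>x * a\<rfloor> - \<lfloor>x * b\<rfloor> + s\<bar> \<le> 1"
proof -
  have "\<bar>x * a - x * b + s\<bar> < 1" using assms by (simp add: algebra_simps)
  then show ?thesis by linarith
qed

context uniform_shifted_walk
begin

lemma return_time_le_of_cell_return:
  assumes K: "K > 0" and n: "\<omega> \<in> space P" "\<omega> \<notin> no_cell_return K n"
    and C: "\<And>v t. t > 0 \<Longrightarrow> (\<And>j. \<bar>v $ j\<bar> \<le> t) \<Longrightarrow> N v < C * t" and \<epsilon>: "C / K \<le> \<epsilon>"
  shows "return_time N (\<lambda>n. walk_process i X Y n \<omega>) \<epsilon> \<le> enat n"
proof -
  obtain m where m: "m \<in> {1..n}" "walk X m \<omega> = 0" "grid_index K (Y 0 \<omega>) = grid_index K (Y m \<omega>)"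
    using n by (auto simp: no_cell_return_def)
  have "\<bar>(Y m \<omega> - Y 0 \<omega>) $ j\<bar> \<le> 1 / K" for j
  proof -
    have "\<lfloor>real K * Y m \<omega> $ j\<rfloor> = \<lfloor>real K * Y 0 \<omega> $ j\<rfloor>"
      using m(3) by (simp add: grid_index_def fun_eq_iff)
    then have "\<bar>real K * Y m \<omega> $ j - real K * Y 0 \<omega> $ j\<bar> \<le> 1" by linarith
    moreover have "\<bar>real K * Y m \<omega> $ j - real K * Y 0 \<omega> $ j\<bar> = \<bar>(Y m \<omega> - Y 0 \<omega>) $ j\<bar> * real K"
      by (simp add: abs_mult mult.commute flip: right_diff_distrib)
    ultimately show ?thesis using K by (simp add: pos_le_divide_eq)
  qed
  then have "N (Y m \<omega> - Y 0 \<omega>) < C * (1 / K)" using K by (intro C) auto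
  then have "N (Y m \<omega> - Y 0 \<omega>) < \<epsilon>" using \<epsilon> by simp
  then have "return_time N (\<lambda>n. walk_process i X Y n \<omega>) \<epsilon> \<le> enat m"
    using m by (intro return_time_le) (auto simp: walk_process_def walk_0)
  also have "\<dots> \<le> enat n" using m by simp
  finally show ?thesis .
qed

lemma return_time_ge_of_no_near_return:
  assumes K: "K > 0" and n: "\<omega> \<in> space P" "\<omega> \<notin> near_return i K n"
    and cube: "\<And>m. Y m \<omega> \<in> unit_cube"
    and c: "\<And>v t j. N v < c * t \<Longrightarrow> \<bar>v $ j\<bar> < t" and \<epsilon>: "\<epsilon> \<le> c / K"
  shows "enat n \<le> return_time N (\<lambda>n. walk_process i X Y n \<omega>) \<epsilon>"
proof (rule ccontr)
  assume "\<not> ?thesis"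
  then have "return_time N (\<lambda>n. walk_process i X Y n \<omega>) \<epsilon> \<le> enat n" by simp
  then obtain m where m: "m \<in> {1..n}"
    and close: "N (walk_process i X Y m \<omega> - walk_process i X Y 0 \<omega>) < \<epsilon>"
    by (rule return_time_leD)
  let ?S = "walk X m \<omega>"
  define shift where "shift j = of_bool (j = i) * int K * ?S" for j
  have diff: "(walk_process i X Y m \<omega> - walk_process i X Y 0 \<omega>) $ j
      = (if j = i then real_of_int ?S else 0) + (Y m \<omega> $ j - Y 0 \<omega> $ j)" for j
    by (simp add: walk_process_def walk_0 axis_def)
  have near: "\<bar>(walk_process i X Y m \<omega> - walk_process i X Y 0 \<omega>) $ j\<bar> < 1 / K" for j
    using close \<epsilon> by (intro c) simp
  have "\<bar>?S\<bar> \<le> 1"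
  proof -
    have "1 / real K \<le> 1" using K by simp
    then have "\<bar>real_of_int ?S + (Y m \<omega> $ i - Y 0 \<omega> $ i)\<bar> < 1"
      using near[of i] unfolding diff by simp
    moreover have "0 < Y m \<omega> $ i" "Y m \<omega> $ i < 1" "0 < Y 0 \<omega> $ i" "Y 0 \<omega> $ i < 1"
      using cube by (auto simp: unit_cube_def)
    ultimately have "\<bar>real_of_int ?S\<bar> < 2" by linarith
    then show ?thesis by linarith
  qed
  then have S: "?S \<in> {-1..1}" by auto
  let ?u = "\<lambda>j. grid_index K (Y m \<omega>) j - grid_index K (Y 0 \<omega>) j + shift j"
  have "\<bar>?u j\<bar> \<le> 1" for j
  proof -
    have "real K * (Y m \<omega> $ j - Y 0 \<omega> $ j) + shift j
        = real K * (walk_process i X Y m \<omega> - walk_process i X Y 0 \<omega>) $ j"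
      unfolding diff shift_def by (simp add: algebra_simps)
    moreover have "\<bar>real K * (walk_process i X Y m \<omega> - walk_process i X Y 0 \<omega>) $ j\<bar> < 1"
      using near[of j] K by (simp only: abs_mult abs_of_nat pos_less_divide_eq of_nat_0_less_iff mult.commute)
    ultimately show ?thesis
      unfolding grid_index_def by (intro floor_difference_le_1) simp
  qed
  then have "-1 \<le> ?u j \<and> ?u j \<le> 1" for j by (simp only: abs_le_iff minus_le_iff)
  then have u: "?u \<in> UNIV \<rightarrow>\<^sub>E {-1..1}" by auto
  have "\<omega> \<in> cell_passage i K m ?S ?u"
    using n(1) grid_index_in_grid[OF cube K] by (auto simp: cell_passage_def shift_def)
  then have "\<omega> \<in> near_return i K n"
    unfolding near_return_def using m S u by blast
  with n(2) show False by contradiction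
qed

section \<open>Almost sure bounds along dyadic scales\<close>

lemma AE_eventually_not_in_of_geometric:
  assumes "\<And>k. A k \<in> sets P" and "\<And>k. prob (A k) \<le> c * (1 / 2) ^ k"
  shows "AE \<omega> in P. \<forall>\<^sub>F k in sequentially. \<omega> \<in> space P - A k"
proof (rule borel_cantelli_AE1)
  have "summable (\<lambda>k. c * (1 / 2 :: real) ^ k)"
    by (intro summable_mult summable_geometric) simp
  then show "summable (\<lambda>k. prob (A k))"
    by (rule summable_comparison_test'[where N = 0]) (use assms(2) in simp)
qed (use assms(1) in \<open>auto simp: emeasure_eq_measure\<close>)

text \<open>
  With \<open>D = d * j\<close>, the time is \<open>t * t\<close> for \<open>t = 2 ^ (k * (D + 2))\<close>, and the number of visits
  asked for is \<open>r = 2 ^ (k * (D + 1))\<close>. This is \<open>2 ^ k\<close> times less than the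
  typical number \<open>t\<close> of visits, so it is reached with high probability, and \<open>2 ^ k\<close> times more than the
  number \<open>2 ^ (k * D)\<close> of cells, so one of the visits is likely to meet the starting cell.
\<close>

lemma AE_eventually_cell_return:
  assumes j: "j \<ge> 1"
  shows "AE \<omega> in P. \<forall>\<^sub>F k in sequentially.
    \<omega> \<in> space P - no_cell_return (2 ^ (j * k)) (4 ^ (k * (CARD('d) * j + 2)))"
proof -
  define D where "D = CARD('d) * j"
  have "prob (no_cell_return (2 ^ (j * k)) (4 ^ (k * (D + 2)))) \<le> 5 * (1 / 2) ^ k" for k
  proof -
    define t r where "t = (2::nat) ^ (k * (D + 2))" and "r = (2::nat) ^ (k * (D + 1))"
    have t: "(4::nat) ^ (k * (D + 2)) = t * t"
      unfolding t_def by (simp flip: power_mult_distrib)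
    have tr: "real t = 2 ^ k * real r"
      by (simp add: t_def r_def algebra_simps flip: power_add)
    have r_pos: "r > 0" and t_pos: "t > 0" by (simp_all add: r_def t_def)
    have "r \<le> t" unfolding t_def r_def by (intro power_increasing) auto
    also have "t \<le> t * t" using t_pos by simp
    finally have "r \<le> t * t" .
    \<comment> \<open>Waiting for \<open>r\<close> visits costs at most \<open>r\<close> pauses, which leaves a fixed share of the time.\<close>
    have "(real t / 2) ^ 2 \<le> real (t * t - r) + 1"
    proof -
      have "real (t * t - r) + 1 - (real t / 2) ^ 2 \<ge> real t * real t - real t + 1 - (real t / 2) ^ 2"
        using \<open>r \<le> t * t\<close> \<open>r \<le> t\<close> by (simp add: of_nat_diff)
      also have "real t * real t - real t + 1 - (real t / 2) ^ 2
          = (real t / 2 - 1) ^ 2 + 2 * (real t / 2) ^ 2"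
        by (simp add: power2_eq_square algebra_simps)
      finally show ?thesis by (smt (verit) zero_le_power2)
    qed
    then have "real t / 2 \<le> sqrt (real (t * t - r) + 1)"
      by (rule real_le_rsqrt)
    then have "2 * real r / sqrt (real (t * t - r) + 1) \<le> 2 * real r / (real t / 2)"
      using t_pos r_pos by (intro divide_left_mono mult_pos_pos) auto
    also have "\<dots> = 4 * (1 / 2) ^ k"
      using r_pos by (simp add: tr power_divide)
    finally have few: "2 * real r / sqrt (real (t * t - r) + 1) \<le> 4 * (1 / 2) ^ k" .
    define p where "p = (1 / real (2 ^ (j * k))) ^ CARD('d)"
    have p: "p = 1 / 2 ^ (k * D)"
      by (simp add: p_def D_def power_divide mult_ac flip: power_mult)
    have "p \<le> 1" by (simp add: p)
    have "(1 - p) ^ r \<le> exp (- p) ^ r"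
      using \<open>p \<le> 1\<close> exp_ge_add_one_self[of "- p"] by (intro power_mono) auto
    also have "\<dots> = exp (- (real r * p))"
      by (simp flip: exp_of_nat_mult)
    also have "real r * p = 2 ^ k" by (simp add: r_def p power_add)
    also have "exp (- (2 ^ k)) \<le> (1 / 2 :: real) ^ k"
    proof -
      have "(2::real) ^ k \<le> exp (2 ^ k)" using exp_ge_add_one_self[of "2 ^ k"] by linarith
      then show ?thesis by (simp add: exp_minus power_divide inverse_eq_divide le_divide_eq divide_le_eq mult.commute)
    qed
    finally have many: "(1 - p) ^ r \<le> (1 / 2) ^ k" .
    have "prob (no_cell_return (2 ^ (j * k)) (t * t)) \<le>
        2 * real r / sqrt (real (t * t - r) + 1) + (1 - p) ^ r"
      unfolding p_def by (rule prob_no_cell_return) simp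
    with few many show ?thesis unfolding t by simp
  qed
  then show ?thesis unfolding D_def by (rule AE_eventually_not_in_of_geometric[rotated]) measurable
qed

text \<open>
  The square root of the time \<open>4 ^ (k * (D - 1))\<close> falls short of the number \<open>2 ^ (k * D)\<close> of cells by
  a factor \<open>2 ^ k\<close>.
\<close>

lemma AE_eventually_no_near_return:
  assumes j: "j \<ge> 1"
  shows "AE \<omega> in P. \<forall>\<^sub>F k in sequentially.
    \<omega> \<in> space P - near_return i (2 ^ (j * k)) (4 ^ (k * (CARD('d) * j - 1)))"
proof -
  define D where "D = CARD('d) * j"
  have D: "D \<ge> 1" using j by (simp add: D_def Suc_le_eq)
  have "prob (near_return i (2 ^ (j * k)) (4 ^ (k * (D - 1)))) \<le> 6 * 3 ^ CARD('d) * (1 / 2) ^ k" for k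
  proof -
    have "real (4 ^ (k * (D - 1))) = (2 ^ (k * (D - 1))) ^ 2"
      by (simp add: power2_eq_square flip: power_mult_distrib)
    then have "sqrt (real (4 ^ (k * (D - 1)))) = 2 ^ (k * (D - 1))" by simp
    moreover have "(1 / real (2 ^ (j * k))) ^ CARD('d) = 1 / 2 ^ (k * D)"
      by (simp add: D_def power_divide mult_ac flip: power_mult)
    moreover have "k * D = k + k * (D - 1)"
      using D by (simp add: algebra_simps flip: mult_Suc_right)
    then have "(1 / 2 ^ (k * D)) * 2 ^ (k * (D - 1)) = (1 / 2 :: real) ^ k"
      by (simp add: power_add power_divide)
    moreover have "prob (near_return i (2 ^ (j * k)) (4 ^ (k * (D - 1))))
        \<le> 6 * 3 ^ CARD('d) * (1 / real (2 ^ (j * k))) ^ CARD('d) * sqrt (real (4 ^ (k * (D - 1))))"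
      by (rule prob_near_return) simp
    ultimately show ?thesis by (simp only: mult.assoc)
  qed
  then show ?thesis unfolding D_def by (rule AE_eventually_not_in_of_geometric[rotated]) measurable
qed

end

section \<open>Interpolation between the scales\<close>

lemma ln_enat_le: "1 \<le> t \<Longrightarrow> t \<le> enat n \<Longrightarrow> ln_enat t \<le> ereal (ln (real n))"
  by (cases t) (auto simp: ln_enat_def one_enat_def)

lemma ln_enat_ge: "n \<ge> 1 \<Longrightarrow> enat n \<le> t \<Longrightarrow> ereal (ln (real n)) \<le> ln_enat t"
  by (cases t) (auto simp: ln_enat_def)

text \<open>
  The scale used for \<open>\<epsilon>\<close> is the first \<open>k\<close> with \<open>C / 2 ^ (j * k) \<le> \<epsilon>\<close>. It exceeds
  the real solution \<open>x\<close> of \<open>C / 2 ^ (j * x) = \<epsilon>\<close> by at most one, which only enters the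
  constant \<open>A\<close>.
\<close>

lemma ln_upper_of_dyadic:
  fixes T :: "real \<Rightarrow> enat"
  assumes C: "C > 0" and j: "j \<ge> 1" and T: "\<And>\<epsilon>. 1 \<le> T \<epsilon>"
    and dyadic: "\<forall>\<^sub>F k in sequentially. \<forall>\<epsilon>\<ge>C / 2 ^ (j * k). T \<epsilon> \<le> enat (4 ^ (k * (d * j + 2)))"
  shows "\<exists>A. \<forall>\<^sub>F \<epsilon> in at_right 0. ln_enat (T \<epsilon>) \<le> ereal ((2 * real d + 4 / real j) * (- ln \<epsilon>) + A)"
proof -
  from dyadic obtain k0
    where k0: "\<And>k \<epsilon>. k \<ge> k0 \<Longrightarrow> C / 2 ^ (j * k) \<le> \<epsilon> \<Longrightarrow> T \<epsilon> \<le> enat (4 ^ (k * (d * j + 2)))"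
    unfolding eventually_sequentially by blast
  define b where "b = 2 * (real d * real j + 2) * ln 2"
  define A where "A = b / (j * ln 2) * ln C + b"
  have b: "b \<ge> 0" by (simp add: b_def)
  have "ln_enat (T \<epsilon>) \<le> ereal ((2 * real d + 4 / real j) * (- ln \<epsilon>) + A)"
    if \<epsilon>: "0 < \<epsilon>" "\<epsilon> < C / 2 ^ (j * k0)" for \<epsilon>
  proof -
    define x where "x = (ln C - ln \<epsilon>) / (j * ln 2)"
    define k where "k = nat \<lceil>x\<rceil>"
    have jln: "real j * ln 2 > 0" using j by simp
    have lt: "ln \<epsilon> < ln C - real k0 * (real j * ln 2)"
    proof -
      have "ln \<epsilon> < ln (C / 2 ^ (j * k0))" using \<epsilon> C by simp
      then show ?thesis using C by (simp add: ln_div ln_realpow mult_ac)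
    qed
    then have x: "x > real k0" using jln by (simp add: x_def pos_less_divide_eq)
    then have "k \<ge> k0" "x \<le> real k" "real k \<le> x + 1" unfolding k_def by linarith+
    have "ln C - ln \<epsilon> = x * (real j * ln 2)" using j by (simp add: x_def)
    also have "\<dots> \<le> real k * (real j * ln 2)" using \<open>x \<le> real k\<close> jln by (intro mult_right_mono) auto
    finally have "ln (C / 2 ^ (j * k)) \<le> ln \<epsilon>" using C by (simp add: ln_div ln_realpow mult_ac)
    then have "C / 2 ^ (j * k) \<le> \<epsilon>" using C \<epsilon> by (subst (asm) ln_le_cancel_iff) auto
    then have "T \<epsilon> \<le> enat (4 ^ (k * (d * j + 2)))" by (rule k0[OF \<open>k \<ge> k0\<close>])
    then have "ln_enat (T \<epsilon>) \<le> ereal (ln (real (4 ^ (k * (d * j + 2)))))" by (rule ln_enat_le[OF T])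
    also have "ln (real (4 ^ (k * (d * j + 2)))) = real k * b"
      using ln_realpow[of 2 2] by (simp add: ln_realpow b_def algebra_simps)
    also have "real k * b \<le> (x + 1) * b" using \<open>real k \<le> x + 1\<close> b by (intro mult_right_mono)
    also have "(x + 1) * b = b / (j * ln 2) * (- ln \<epsilon>) + A"
      unfolding x_def A_def by (simp add: algebra_simps diff_divide_distrib)
    also have "b / (j * ln 2) = 2 * real d + 4 / real j"
      using j by (simp add: b_def field_simps)
    finally show ?thesis by simp
  qed
  then show ?thesis
    using C by (intro exI[of _ A] eventually_at_rightI[of 0 "C / 2 ^ (j * k0)"]) simp_all
qed

text \<open>
  As for the upper bound, now with the last \<open>k\<close> such that \<open>\<epsilon> \<le> c / 2 ^ (j * k)\<close>.
\<close>

lemma ln_lower_of_dyadic: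
  fixes T :: "real \<Rightarrow> enat"
  assumes c: "c > 0" and j: "j \<ge> 1" and d: "d \<ge> 1"
    and dyadic: "\<forall>\<^sub>F k in sequentially. \<forall>\<epsilon>\<le>c / 2 ^ (j * k). enat (4 ^ (k * (d * j - 1))) \<le> T \<epsilon>"
  shows "\<exists>A. \<forall>\<^sub>F \<epsilon> in at_right 0. ereal ((2 * real d - 2 / real j) * (- ln \<epsilon>) - A) \<le> ln_enat (T \<epsilon>)"
proof -
  from dyadic obtain k0
    where k0: "\<And>k \<epsilon>. k \<ge> k0 \<Longrightarrow> \<epsilon> \<le> c / 2 ^ (j * k) \<Longrightarrow> enat (4 ^ (k * (d * j - 1))) \<le> T \<epsilon>"
    unfolding eventually_sequentially by blast
  have dj: "d * j \<ge> 1" using d j by simp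
  define b where "b = 2 * (real d * real j - 1) * ln 2"
  define A where "A = b - b / (j * ln 2) * ln c"
  have b: "b \<ge> 0" using dj by (simp add: b_def flip: of_nat_mult)
  have "ereal ((2 * real d - 2 / real j) * (- ln \<epsilon>) - A) \<le> ln_enat (T \<epsilon>)"
    if \<epsilon>: "0 < \<epsilon>" "\<epsilon> < c / 2 ^ (j * k0)" for \<epsilon>
  proof -
    define x where "x = (ln c - ln \<epsilon>) / (j * ln 2)"
    define k where "k = nat \<lfloor>x\<rfloor>"
    have jln: "real j * ln 2 > 0" using j by simp
    have lt: "ln \<epsilon> < ln c - real k0 * (real j * ln 2)"
    proof -
      have "ln \<epsilon> < ln (c / 2 ^ (j * k0))" using \<epsilon> c by simp
      then show ?thesis using c by (simp add: ln_div ln_realpow mult_ac)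
    qed
    then have x: "x > real k0" using jln by (simp add: x_def pos_less_divide_eq)
    then have "k \<ge> k0" "real k \<le> x" "x - 1 \<le> real k" unfolding k_def by linarith+
    have "real k * (real j * ln 2) \<le> x * (real j * ln 2)"
      using \<open>real k \<le> x\<close> jln by (intro mult_right_mono) auto
    also have "\<dots> = ln c - ln \<epsilon>" using j by (simp add: x_def)
    finally have "ln \<epsilon> \<le> ln (c / 2 ^ (j * k))" using c by (simp add: ln_div ln_realpow mult_ac)
    then have "\<epsilon> \<le> c / 2 ^ (j * k)" using c \<epsilon> by (subst (asm) ln_le_cancel_iff) auto
    then have T: "enat (4 ^ (k * (d * j - 1))) \<le> T \<epsilon>" by (rule k0[OF \<open>k \<ge> k0\<close>])
    have "2 * real d - 2 / real j = b / (j * ln 2)"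
      using j by (simp add: b_def field_simps)
    then have "(2 * real d - 2 / real j) * (- ln \<epsilon>) - A = (x - 1) * b"
      unfolding x_def A_def by (simp add: algebra_simps diff_divide_distrib)
    also have "\<dots> \<le> real k * b" using \<open>x - 1 \<le> real k\<close> b by (intro mult_right_mono)
    also have "real k * b = ln (real (4 ^ (k * (d * j - 1))))"
      using ln_realpow[of 2 2] dj by (simp add: ln_realpow b_def of_nat_diff algebra_simps)
    finally have "ereal ((2 * real d - 2 / real j) * (- ln \<epsilon>) - A)
        \<le> ereal (ln (real (4 ^ (k * (d * j - 1)))))" by simp
    also have "\<dots> \<le> ln_enat (T \<epsilon>)" using T by (intro ln_enat_ge) auto
    finally show ?thesis .
  qed
  then show ?thesis
    using c by (intro exI[of _ A] eventually_at_rightI[of 0 "c / 2 ^ (j * k0)"]) simp_all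
qed

lemma tendsto_quotient_neg_ln:
  fixes a A :: real
  shows "((\<lambda>\<epsilon>. ereal ((a * (- ln \<epsilon>) + A) / (- ln \<epsilon>))) \<longlongrightarrow> ereal a) (at_right 0)"
proof -
  have ln: "filterlim (\<lambda>\<epsilon>::real. - ln \<epsilon>) at_top (at_right 0)"
    using ln_at_0 by (simp add: filterlim_uminus_at_top)
  have "((\<lambda>\<epsilon>. a + A / (- ln \<epsilon>)) \<longlongrightarrow> a + 0) (at_right 0)"
    by (intro tendsto_add tendsto_const real_tendsto_divide_at_top[OF tendsto_const ln])
  moreover have "\<forall>\<^sub>F \<epsilon> in at_right 0. a + A / (- ln \<epsilon>) = (a * (- ln \<epsilon>) + A) / (- ln \<epsilon>)"
    using filterlim_at_top_dense[THEN iffD1, OF ln, rule_format, of 0]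
    by eventually_elim (simp add: field_simps)
  ultimately have "((\<lambda>\<epsilon>. (a * (- ln \<epsilon>) + A) / (- ln \<epsilon>)) \<longlongrightarrow> a) (at_right 0)"
    by (auto intro: Lim_transform_eventually)
  then show ?thesis by simp
qed

text \<open>
  The additive constants disappear after division by \<open>- ln \<epsilon>\<close>, and \<open>j\<close> is arbitrary. The
  constants may depend on \<open>j\<close> without any uniformity, so each bound on the limit is treated with a
  fixed \<open>j\<close>.
\<close>

lemma tendsto_of_ln_bounds:
  fixes L :: "real \<Rightarrow> ereal"
  assumes upper: "\<And>j. j \<ge> 1 \<Longrightarrow> \<exists>A. \<forall>\<^sub>F \<epsilon> in at_right 0. L \<epsilon> \<le> ereal ((a + 4 / real j) * (- ln \<epsilon>) + A)"
    and lower: "\<And>j. j \<ge> 1 \<Longrightarrow> \<exists>A. \<forall>\<^sub>F \<epsilon> in at_right 0. ereal ((a - 2 / real j) * (- ln \<epsilon>) - A) \<le> L \<epsilon>"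
  shows "((\<lambda>\<epsilon>. L \<epsilon> / ereal (- ln \<epsilon>)) \<longlongrightarrow> ereal a) (at_right 0)"
proof (rule order_tendstoI)
  have "filterlim (\<lambda>\<epsilon>::real. - ln \<epsilon>) at_top (at_right 0)"
    using ln_at_0 by (simp add: filterlim_uminus_at_top)
  then have pos: "\<forall>\<^sub>F \<epsilon> in at_right (0::real). 0 < - ln \<epsilon>"
    unfolding filterlim_at_top_dense by blast
  have choose: "\<exists>j\<ge>1. c / real j < e" if "e > 0" "c > 0" for c e :: real
  proof -
    have "0 < e / c" using that by simp
    then obtain n where n: "inverse (real (Suc n)) < e / c"
      using reals_Archimedean by blast
    then have "c / real (Suc n) < e" using that by (simp add: field_simps)
    then show ?thesis by (intro exI[of _ "Suc n"]) simp
  qed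
  fix y :: ereal
  {
    assume "y < ereal a"
    then obtain z where z: "y < ereal z" "z < a" using ereal_dense2 by force
    obtain j where j: "j \<ge> 1" "2 / real j < a - z" using choose[of "a - z" 2] z by auto
    obtain A where A: "\<forall>\<^sub>F \<epsilon> in at_right 0. ereal ((a - 2 / real j) * (- ln \<epsilon>) - A) \<le> L \<epsilon>"
      using lower[OF j(1)] by blast
    have "y < ereal (a - 2 / real j)" using z j by (auto intro: less_trans)
    with order_tendstoD(1)[OF tendsto_quotient_neg_ln[of "a - 2 / real j" "- A"]]
    have "\<forall>\<^sub>F \<epsilon> in at_right 0. y < ereal (((a - 2 / real j) * (- ln \<epsilon>) + - A) / (- ln \<epsilon>))" by blast
    with A pos show "\<forall>\<^sub>F \<epsilon> in at_right 0. y < L \<epsilon> / ereal (- ln \<epsilon>)"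
    proof eventually_elim
      case (elim \<epsilon>)
      then have "ereal ((a - 2 / real j) * (- ln \<epsilon>) - A) / ereal (- ln \<epsilon>) \<le> L \<epsilon> / ereal (- ln \<epsilon>)"
        by (intro ereal_divide_right_mono) auto
      with elim show ?case by (auto simp: less_le_trans)
    qed
  }
  {
    assume "ereal a < y"
    then obtain z where z: "ereal z < y" "a < z" using ereal_dense2 by force
    obtain j where j: "j \<ge> 1" "4 / real j < z - a" using choose[of "z - a" 4] z by auto
    obtain A where A: "\<forall>\<^sub>F \<epsilon> in at_right 0. L \<epsilon> \<le> ereal ((a + 4 / real j) * (- ln \<epsilon>) + A)"
      using upper[OF j(1)] by blast
    have "ereal (a + 4 / real j) < y" using z j by (auto intro: less_trans[rotated])
    with order_tendstoD(2)[OF tendsto_quotient_neg_ln[of "a + 4 / real j" A]]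
    have "\<forall>\<^sub>F \<epsilon> in at_right 0. ereal (((a + 4 / real j) * (- ln \<epsilon>) + A) / (- ln \<epsilon>)) < y" by blast
    with A pos show "\<forall>\<^sub>F \<epsilon> in at_right 0. L \<epsilon> / ereal (- ln \<epsilon>) < y"
    proof eventually_elim
      case (elim \<epsilon>)
      then have "L \<epsilon> / ereal (- ln \<epsilon>) \<le> ereal ((a + 4 / real j) * (- ln \<epsilon>) + A) / ereal (- ln \<epsilon>)"
        by (intro ereal_divide_right_mono) auto
      with elim show ?case by (auto simp: le_less_trans)
    qed
  }
qed

theorem theorem2p1:
  fixes P :: "'w measure"
    and X :: "nat \<Rightarrow> 'w \<Rightarrow> int"
    and Y :: "nat \<Rightarrow> 'w \<Rightarrow> real ^ 'd::finite"
    and i :: 'd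
    and N :: "real ^ 'd \<Rightarrow> real"
  assumes "prob_space P"
    and "prob_space.indep_vars P (\<lambda>_. borel) Y UNIV"
    and "\<And>n. distr P borel (Y n) = uniform_measure lborel unit_cube"
    and "prob_space.indep_vars P (\<lambda>_. count_space UNIV) X {1..}"
    and "\<And>k. k \<ge> 1 \<Longrightarrow> \<P>(\<omega> in P. X k \<omega> = 1) = 1 / 2"
    and "\<And>k. k \<ge> 1 \<Longrightarrow> \<P>(\<omega> in P. X k \<omega> = -1) = 1 / 2"
    and "prob_space.indep_set P
           (generated_sets P (count_space UNIV) (walk X)) (generated_sets P borel Y)"
    and "is_norm N"
  shows "AE \<omega> in P.
           ((\<lambda>\<epsilon>. ln_enat (return_time N (\<lambda>n. walk_process i X Y n \<omega>) \<epsilon>) / ereal (- ln \<epsilon>))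
             \<longlongrightarrow> ereal (2 * real CARD('d))) (at_right 0)"
proof -
  interpret uniform_shifted_walk P X Y
    using assms(1-7) by (auto simp: uniform_shifted_walk_def uniform_shifted_walk_axioms_def)
  obtain c C where "c > 0" "C > 0"
    and c: "\<And>v t j. N v < c * t \<Longrightarrow> \<bar>v $ j\<bar> < t"
    and C: "\<And>v t. t > 0 \<Longrightarrow> (\<And>j. \<bar>v $ j\<bar> \<le> t) \<Longrightarrow> N v < C * t"
    using is_norm_bounds[OF assms(8)] by blast
  have "AE \<omega> in P. \<forall>j. j \<ge> 1 \<longrightarrow> (\<forall>\<^sub>F k in sequentially.
      \<omega> \<in> space P - no_cell_return (2 ^ (j * k)) (4 ^ (k * (CARD('d) * j + 2))))"
    unfolding AE_all_countable using AE_eventually_cell_return by auto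
  moreover have "AE \<omega> in P. \<forall>j. j \<ge> 1 \<longrightarrow> (\<forall>\<^sub>F k in sequentially.
      \<omega> \<in> space P - near_return i (2 ^ (j * k)) (4 ^ (k * (CARD('d) * j - 1))))"
    unfolding AE_all_countable using AE_eventually_no_near_return by auto
  moreover have "AE \<omega> in P. \<forall>n. Y n \<omega> \<in> unit_cube"
    unfolding AE_all_countable using AE_unit_cube by blast
  ultimately show ?thesis
  proof eventually_elim
    case (elim \<omega>)
    let ?T = "return_time N (\<lambda>n. walk_process i X Y n \<omega>)"
    show ?case
    proof (rule tendsto_of_ln_bounds)
      fix j :: nat assume j: "j \<ge> 1"
      have "\<forall>\<^sub>F k in sequentially. \<forall>\<epsilon>\<ge>C / 2 ^ (j * k). ?T \<epsilon> \<le> enat (4 ^ (k * (CARD('d) * j + 2)))"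
        using elim(1)[rule_format, OF j]
      proof (eventually_elim, intro allI impI)
        fix k \<epsilon>
        assume "\<omega> \<in> space P - no_cell_return (2 ^ (j * k)) (4 ^ (k * (CARD('d) * j + 2)))"
          and "C / 2 ^ (j * k) \<le> \<epsilon>"
        then show "?T \<epsilon> \<le> enat (4 ^ (k * (CARD('d) * j + 2)))"
          using C by (intro return_time_le_of_cell_return[of "2 ^ (j * k)" _ _ _ C]) auto
      qed
      from ln_upper_of_dyadic[OF \<open>C > 0\<close> j return_time_ge_1 this]
      show "\<exists>A. \<forall>\<^sub>F \<epsilon> in at_right 0.
          ln_enat (?T \<epsilon>) \<le> ereal ((2 * real CARD('d) + 4 / real j) * (- ln \<epsilon>) + A)" .
      have "\<forall>\<^sub>F k in sequentially. \<forall>\<epsilon>\<le>c / 2 ^ (j * k). enat (4 ^ (k * (CARD('d) * j - 1))) \<le> ?T \<epsilon>"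
        using elim(2)[rule_format, OF j]
      proof (eventually_elim, intro allI impI)
        fix k \<epsilon>
        assume "\<omega> \<in> space P - near_return i (2 ^ (j * k)) (4 ^ (k * (CARD('d) * j - 1)))"
          and "\<epsilon> \<le> c / 2 ^ (j * k)"
        then show "enat (4 ^ (k * (CARD('d) * j - 1))) \<le> ?T \<epsilon>"
          using elim(3) c by (intro return_time_ge_of_no_near_return[of "2 ^ (j * k)" _ i _ _ c]) auto
      qed
      from ln_lower_of_dyadic[OF \<open>c > 0\<close> j _ this]
      show "\<exists>A. \<forall>\<^sub>F \<epsilon> in at_right 0.
          ereal ((2 * real CARD('d) - 2 / real j) * (- ln \<epsilon>) - A) \<le> ln_enat (?T \<epsilon>)"
        by (simp add: Suc_le_eq)
    qed
  qed
qed

end
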